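(* Let $\Delta$ be a simplicial complex with vertices $1,\ldots,n$ which is not the boundary of a simplex, and let $k$ be a field. Let $S=k[x_\sigma : \sigma\in\Delta]$ be the polynomial ring with one variable $x_\sigma$ for each face $\sigma$ of $\Delta$. For each vertex $v$ let $A_\Delta(v)$ be the set of facets of $\Delta$ that do not contain $v$, let $B_\Delta(v)$ be the set of facets of $\Delta$ that contain $v$, and put $$m'_v=\sqrt{\ \prod_{G\in B_\Delta(v)} x_{G\setminus\{v\}}\ \prod_{F\in A_\Delta(v)}\Big(x_F\prod_{\sigma\subset F,\ |\sigma|=|F|-1} x_\sigma\Big)}\,,\qquad v=1,\ldots,n,$$ where $\sqrt{\cdot}$ of a monomial denotes the product of the distinct variables dividing it. Let $J'_\Delta=(m'_1,\ldots,m'_n)\subseteq S$. Then: 1. $\Delta$ is the Scarf complex of $J'_\Delta$ (with vertex $v$ corresponding to the generator $m'_v$). 2. If $\Delta$ is acyclic (in particular, if $\Delta$ is a simplicial tree), then $J'_\Delta$ is a Scarf ideal.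
   Context: A simplicial complex $\Delta$ on a nonempty finite vertex set $V$ is a collection of subsets of $V$ (faces, including $\emptyset$), closed under taking subsets, with $\{v\}\in\Delta$ for all $v\in V$. Facets are the faces maximal under inclusion. $\Delta$ is the boundary of a simplex if its faces are exactly the proper subsets of $V$. A subcollection of $\Delta$ is a simplicial complex generated by a subset of the set of facets of $\Delta$. A facet $F$ of a simplicial complex is a leaf if either it is the only facet, or there is a facet $G\neq F$ such that $F\cap H\subseteq G$ for every facet $H\neq F$. A simplicial tree is a connected simplicial complex such that every nonempty subcollection (i.e. generated by a nonempty set of facets) has a leaf. Acyclic means that the reduced simplicial homology with coefficients in $k$ vanishes in all degrees. Scarf complex: let $I$ be a monomial ideal with minimal monomial generators $m_1,\ldots,m_n$. Label each subset $A\subseteq\{1,\ldots,n\}$ by $m_A=\mathrm{lcm}(m_i : i\in A)$, with $m_\emptyset=1$. The Scarf complex of $I$ is the simplicial complex of all $A\subseteq\{1,\ldots,n\}$ such that $m_B\neq m_A$ for every $B\subseteq\{1,\ldots,n\}$ with $B\neq A$. Scarf ideal: for a simplicial complex $\Gamma$ with vertices $1,\ldots,n$ labeled by monomials $m_1,\ldots,m_n$ and each face $A$ labeled by $m_A=\mathrm{lcm}(m_i : i\in A)$, with $m_\emptyset=1$, $\mathcal{C}(\Gamma;S)$ is the complex of free $S$-modules with basis $\{e_A : A\in\Gamma\}$ (including $A=\emptyset$), $e_A$ in homological degree $|A|$, with differential $\partial(e_A)=\sum_{i\in A}\mathrm{sign}(i,A)\frac{m_A}{m_{A\setminus\{i\}}}e_{A\setminus\{i\}}$,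 where $\mathrm{sign}(i,A)=(-1)^{j-1}$ if $i$ is the $j$-th smallest element of $A$. A monomial ideal $I$ is a Scarf ideal if, for $\Gamma$ its Scarf complex, $\mathcal{C}(\Gamma;S)$ is a (minimal) free resolution of $S/I$. *)

theory Defs
  imports "HOL-Library.Multiset" "HOL-Library.Poly_Mapping" "HOL-Algebra.QuotRing"
begin

section \<open>Simplicial complexes\<close>

definition simplicial_complex :: "'a set \<Rightarrow> 'a set set \<Rightarrow> bool" where
  "simplicial_complex V \<Delta> \<longleftrightarrow>
     finite V \<and> V \<noteq> {} \<and> \<Delta> \<subseteq> Pow V \<and> {} \<in> \<Delta> \<and>
     (\<forall>A\<in>\<Delta>. \<forall>B. B \<subseteq> A \<longrightarrow> B \<in> \<Delta>) \<and> (\<forall>v\<in>V. {v} \<in> \<Delta>)"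

definition facets :: "'a set set \<Rightarrow> 'a set set" where
  "facets \<Delta> = {F \<in> \<Delta>. \<forall>G\<in>\<Delta>. F \<subseteq> G \<longrightarrow> G = F}"

definition boundary_of_simplex :: "'a set \<Rightarrow> 'a set set \<Rightarrow> bool" where
  "boundary_of_simplex V \<Delta> \<longleftrightarrow> \<Delta> = {A. A \<subset> V}"

definition complex_generated_by :: "'a set set \<Rightarrow> 'a set set" where
  "complex_generated_by \<F> = {A. \<exists>F\<in>\<F>. A \<subseteq> F}"

definition leaf :: "'a set set \<Rightarrow> 'a set \<Rightarrow> bool" where
  "leaf \<Delta> F \<longleftrightarrow> F \<in> facets \<Delta> \<and>
     (facets \<Delta> = {F} \<or>
      (\<exists>G\<in>facets \<Delta>. G \<noteq> F \<and> (\<forall>H\<in>facets \<Delta>. H \<noteq> F \<longrightarrow> F \<inter> H \<subseteq> G)))"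

text \<open>Connectedness in terms of edge paths between vertices.\<close>

definition connected_complex :: "'a set \<Rightarrow> 'a set set \<Rightarrow> bool" where
  "connected_complex V \<Delta> \<longleftrightarrow> (\<forall>u\<in>V. \<forall>v\<in>V. (u, v) \<in> {(a, b). {a, b} \<in> \<Delta>}\<^sup>*)"

definition simplicial_tree :: "'a set \<Rightarrow> 'a set set \<Rightarrow> bool" where
  "simplicial_tree V \<Delta> \<longleftrightarrow>
     simplicial_complex V \<Delta> \<and> connected_complex V \<Delta> \<and>
     (\<forall>\<F>. \<F> \<subseteq> facets \<Delta> \<and> \<F> \<noteq> {} \<longrightarrow> (\<exists>F. leaf (complex_generated_by \<F>) F))"

section \<open>Reduced simplicial homology over a field\<close>

text \<open>If \<open>i\<close> is the \<open>j\<close>-th smallest element of \<open>A\<close>, then \<open>j - 1\<close> elements of \<open>A\<close> are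
  smaller than \<open>i\<close>.\<close>

definition face_sign :: "nat \<Rightarrow> nat set \<Rightarrow> 'r::comm_ring_1" where
  "face_sign i A = (- 1) ^ card {a \<in> A. a < i}"

text \<open>Chains are finitely supported functions on faces. They are graded by cardinality, so
  index \<open>j\<close> is the homological degree \<open>j - 1\<close>; in particular \<open>j = 0\<close> is degree \<open>-1\<close>, spanned
  by the empty face.\<close>

definition reduced_chains :: "nat set set \<Rightarrow> nat \<Rightarrow> (nat set \<Rightarrow>\<^sub>0 'k::field) set" where
  "reduced_chains \<Delta> j = {c. \<forall>A\<in>Poly_Mapping.keys c. A \<in> \<Delta> \<and> card A = j}"

definition simplicial_boundary :: "(nat set \<Rightarrow>\<^sub>0 'k::field) \<Rightarrow> (nat set \<Rightarrow>\<^sub>0 'k)" where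
  "simplicial_boundary c =
     (\<Sum>A\<in>Poly_Mapping.keys c. \<Sum>i\<in>A.
        Poly_Mapping.single (A - {i}) (Poly_Mapping.lookup c A * face_sign i A))"

definition acyclic_over :: "'k::field itself \<Rightarrow> nat set set \<Rightarrow> bool" where
  "acyclic_over (K :: 'k itself) \<Delta> \<longleftrightarrow>
     (\<forall>j. {c \<in> (reduced_chains \<Delta> j :: (nat set \<Rightarrow>\<^sub>0 'k) set). simplicial_boundary c = 0} =
          simplicial_boundary ` reduced_chains \<Delta> (Suc j))"

section \<open>Polynomial rings and monomial ideals\<close>

text \<open>A monomial is the multiset of the variables occurring in it, with multiplicity. Thus the
  product of monomials is \<open>+\<close>, divisibility is \<open>\<subseteq>#\<close>, and an exact quotient is \<open>-\<close>.\<close>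

type_synonym ('v, 'k) mpoly = "'v multiset \<Rightarrow>\<^sub>0 'k"

definition poly_ring :: "'v set \<Rightarrow> ('v, 'k::field) mpoly ring" where
  "poly_ring X =
     \<lparr>carrier = {p. \<forall>t\<in>Poly_Mapping.keys p. set_mset t \<subseteq> X},
      mult = (*), one = 1, zero = 0, add = (+)\<rparr>"

definition monomial :: "'v multiset \<Rightarrow> ('v, 'k::field) mpoly" where
  "monomial t = Poly_Mapping.single t 1"

text \<open>The product of the distinct variables dividing a monomial.\<close>

definition mono_sqrt :: "'v multiset \<Rightarrow> 'v multiset" where
  "mono_sqrt t = mset_set (set_mset t)"

text \<open>The library's \<open>Sup\<close> on multisets is the supremum with respect to \<open>\<subseteq>#\<close>, that is, the
  least common multiple; moreover \<open>Sup {} = {#}\<close>, the monomial \<open>1\<close>.\<close>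

definition lcm_label :: "('i \<Rightarrow> 'v multiset) \<Rightarrow> 'i set \<Rightarrow> 'v multiset" where
  "lcm_label m A = Sup (m ` A)"

definition minimal_monomial_generators ::
  "'v set \<Rightarrow> nat \<Rightarrow> (nat \<Rightarrow> 'v multiset) \<Rightarrow> ('v, 'k::field) mpoly set \<Rightarrow> bool" where
  "minimal_monomial_generators X n m I \<longleftrightarrow>
     inj_on m {1..n} \<and> (\<forall>i\<in>{1..n}. set_mset (m i) \<subseteq> X) \<and>
     I = genideal (poly_ring X) (monomial ` m ` {1..n}) \<and>
     (\<forall>M. M \<subset> m ` {1..n} \<longrightarrow> I \<noteq> genideal (poly_ring X) (monomial ` M))"

section \<open>Scarf complexes and Scarf ideals\<close>

definition scarf_complex :: "nat \<Rightarrow> (nat \<Rightarrow> 'v multiset) \<Rightarrow> nat set set" where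
  "scarf_complex n m =
     {A. A \<subseteq> {1..n} \<and> (\<forall>B. B \<subseteq> {1..n} \<and> B \<noteq> A \<longrightarrow> lcm_label m B \<noteq> lcm_label m A)}"

text \<open>The free module in homological degree \<open>j\<close> of the complex supported on a labeled simplicial
  complex \<open>\<Gamma>\<close>; the basis element \<open>e\<^sub>A\<close> is \<open>Poly_Mapping.single A 1\<close>.\<close>

definition free_chains ::
  "'v set \<Rightarrow> nat set set \<Rightarrow> nat \<Rightarrow> (nat set \<Rightarrow>\<^sub>0 ('v, 'k::field) mpoly) set" where
  "free_chains X \<Gamma> j =
     {c. \<forall>A\<in>Poly_Mapping.keys c.
           A \<in> \<Gamma> \<and> card A = j \<and> Poly_Mapping.lookup c A \<in> carrier (poly_ring X)}"

definition labeled_boundary ::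
  "(nat \<Rightarrow> 'v multiset) \<Rightarrow> (nat set \<Rightarrow>\<^sub>0 ('v, 'k::field) mpoly) \<Rightarrow>
     (nat set \<Rightarrow>\<^sub>0 ('v, 'k) mpoly)" where
  "labeled_boundary m c =
     (\<Sum>A\<in>Poly_Mapping.keys c. \<Sum>i\<in>A.
        Poly_Mapping.single (A - {i})
          (Poly_Mapping.lookup c A *
             (face_sign i A * monomial (lcm_label m A - lcm_label m (A - {i})))))"

text \<open>The map from degree \<open>0\<close> to \<open>S/I\<close> sending the basis element of the empty face to \<open>1 + I\<close>.\<close>

definition augmentation ::
  "'v set \<Rightarrow> ('v, 'k::field) mpoly set \<Rightarrow> (nat set \<Rightarrow>\<^sub>0 ('v, 'k) mpoly) \<Rightarrow> ('v, 'k) mpoly set"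
  where
  "augmentation X I c = I +>\<^bsub>poly_ring X\<^esub> Poly_Mapping.lookup c {}"

text \<open>Exactness of \<open>\<dots> \<rightarrow> C\<^sub>2 \<rightarrow> C\<^sub>1 \<rightarrow> C\<^sub>0 \<rightarrow> S/I \<rightarrow> 0\<close>.\<close>

definition resolves_quotient ::
  "'v set \<Rightarrow> nat set set \<Rightarrow> (nat \<Rightarrow> 'v multiset) \<Rightarrow> ('v, 'k::field) mpoly set \<Rightarrow> bool" where
  "resolves_quotient X \<Gamma> m I \<longleftrightarrow>
     (\<forall>j\<ge>1. {c \<in> (free_chains X \<Gamma> j :: (nat set \<Rightarrow>\<^sub>0 ('v, 'k) mpoly) set).
               labeled_boundary m c = 0} =
             labeled_boundary m ` free_chains X \<Gamma> (Suc j)) \<and>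
     {c \<in> free_chains X \<Gamma> 0. augmentation X I c = \<zero>\<^bsub>poly_ring X Quot I\<^esub>} =
       labeled_boundary m ` free_chains X \<Gamma> 1 \<and>
     augmentation X I ` free_chains X \<Gamma> 0 = carrier (poly_ring X Quot I)"

text \<open>Minimality of the resolution: the differentials map into the multiple of the free modules
  by the ideal generated by all variables. The second argument only fixes the field.\<close>

definition minimal_differential ::
  "'v set \<Rightarrow> 'k::field itself \<Rightarrow> nat set set \<Rightarrow> (nat \<Rightarrow> 'v multiset) \<Rightarrow> bool" where
  "minimal_differential X (K :: 'k itself) \<Gamma> m \<longleftrightarrow>
     (\<forall>j\<ge>1. \<forall>c \<in> (free_chains X \<Gamma> j :: (nat set \<Rightarrow>\<^sub>0 ('v, 'k) mpoly) set). \<forall>B.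
        Poly_Mapping.lookup (labeled_boundary m c) B
          \<in> genideal (poly_ring X) ((\<lambda>x. monomial {#x#}) ` X))"

text \<open>The numbering of the minimal generators is immaterial: renumbering gives an isomorphic
  complex.\<close>

definition scarf_ideal :: "'v set \<Rightarrow> ('v, 'k::field) mpoly set \<Rightarrow> bool" where
  "scarf_ideal X I \<longleftrightarrow>
     (\<exists>n m. minimal_monomial_generators X n m I \<and>
        resolves_quotient X (scarf_complex n m) m I \<and>
        minimal_differential X TYPE('k) (scarf_complex n m) m)"

section \<open>The ideal of a simplicial complex\<close>

text \<open>The variable \<open>x\<^sub>\<sigma>\<close> is the face \<open>\<sigma>\<close> itself, so the polynomial ring is \<open>poly_ring \<Delta>\<close>.\<close>

definition facets_avoiding :: "nat set set \<Rightarrow> nat \<Rightarrow> nat set set" where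
  "facets_avoiding \<Delta> v = {F \<in> facets \<Delta>. v \<notin> F}"

definition facets_containing :: "nat set set \<Rightarrow> nat \<Rightarrow> nat set set" where
  "facets_containing \<Delta> v = {F \<in> facets \<Delta>. v \<in> F}"

definition vertex_monomial :: "nat set set \<Rightarrow> nat \<Rightarrow> nat set multiset" where
  "vertex_monomial \<Delta> v = mono_sqrt (
     (\<Sum>G\<in>facets_containing \<Delta> v. {#G - {v}#}) +
     (\<Sum>F\<in>facets_avoiding \<Delta> v.
        {#F#} + (\<Sum>\<sigma> | \<sigma> \<subset> F \<and> card \<sigma> = card F - 1. {#\<sigma>#})))"

definition J_ideal :: "nat \<Rightarrow> nat set set \<Rightarrow> (nat set, 'k::field) mpoly set" where
  "J_ideal n \<Delta> =
     genideal (poly_ring \<Delta>) ((\<lambda>v. monomial (vertex_monomial \<Delta> v)) ` {1..n})"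

end

theory Submission
  imports Defs
begin

text \<open>Let \<open>T\<close> consist of the facets and of the facets with one vertex removed. The radical monomial
  \<open>m'\<^sub>v\<close> is the product of the variables \<open>x\<^sub>\<tau>\<close> with \<open>\<tau> \<in> T\<close> and \<open>v \<notin> \<tau>\<close>, so the label of \<open>A\<close> is the
  product of the \<open>x\<^sub>\<tau>\<close> with \<open>A\<close> not contained in \<open>\<tau>\<close>. A face is the intersection of the members of
  \<open>T\<close> above it and is therefore determined by its label, while all nonfaces share one label, and
  exactly one nonface means that \<open>\<Delta>\<close> is the boundary of a simplex. The strand
  of the complex in multidegree \<open>t\<close> is the chain complex of the faces lying in every \<open>\<tau> \<in> T\<close> with
  \<open>x\<^sub>\<tau>\<close> not dividing \<open>t\<close>: this is \<open>\<Delta>\<close> itself, or a simplex, or \<open>{{}}\<close>, which contributes only to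
  \<open>S/I\<close>. Simplicial trees are acyclic by
  induction on the facets: a leaf meets the rest of the tree in a nonempty simplex.\<close>

section \<open>Chains as functions on faces\<close>

text \<open>Chains are handled as functions on sets, and the boundary is computed coefficientwise:
  the face \<open>B\<close> receives contributions from the faces \<open>insert i B\<close>. This avoids all bookkeeping of
  finite supports; \<open>V\<close> is any finite set containing all the vertices.\<close>

definition bd :: "nat set \<Rightarrow> (nat set \<Rightarrow> 'k) \<Rightarrow> nat set \<Rightarrow> 'k::comm_ring_1" where
  "bd V f B = (\<Sum>i\<in>V - B. f (insert i B) * face_sign i B)"

text \<open>The index is the number of vertices, as in \<open>reduced_chains\<close>, so the empty
  face sits in index 0.\<close>

definition chain :: "nat set set \<Rightarrow> nat \<Rightarrow> (nat set \<Rightarrow> 'k::zero) \<Rightarrow> bool" where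
  "chain \<Gamma> j f \<longleftrightarrow> (\<forall>A. f A \<noteq> 0 \<longrightarrow> A \<in> \<Gamma> \<and> card A = j)"

text \<open>Only the inclusion of cycles in boundaries; the reverse one comes from
  \<open>bd_bd\<close>. The complex \<open>{{}}\<close> fails this at index 0, where the empty face
  is a cycle but not a boundary.\<close>

definition exact_at :: "'k::comm_ring_1 itself \<Rightarrow> nat set \<Rightarrow> nat set set \<Rightarrow> nat \<Rightarrow> bool" where
  "exact_at (K :: 'k itself) V \<Gamma> j \<longleftrightarrow>
     (\<forall>f :: nat set \<Rightarrow> 'k. chain \<Gamma> j f \<and> bd V f = (\<lambda>_. 0) \<longrightarrow>
        (\<exists>g. chain \<Gamma> (Suc j) g \<and> bd V g = f))"

definition down_closed :: "'a set set \<Rightarrow> bool" where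
  "down_closed \<Gamma> \<longleftrightarrow> (\<forall>A\<in>\<Gamma>. \<forall>B. B \<subseteq> A \<longrightarrow> B \<in> \<Gamma>)"

section \<open>Signs and the vanishing of the squared boundary\<close>

lemma face_sign_insert_self: "face_sign i (insert i B) = face_sign i B"
proof -
  have "{a \<in> insert i B. a < i} = {a \<in> B. a < i}"
    by auto
  then show ?thesis
    by (simp add: face_sign_def)
qed

lemma face_sign_insert:
  assumes "finite B" "j \<notin> B"
  shows "face_sign i (insert j B) = (if j < i then - face_sign i B else face_sign i B)"
proof -
  have "{a \<in> insert j B. a < i} = (if j < i then insert j {a \<in> B. a < i} else {a \<in> B. a < i})"
    by auto
  then show ?thesis
    using assms by (auto simp: face_sign_def)
qed

lemma face_sign_cancel: "face_sign i B * (face_sign i B * x) = x"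
  by (simp add: face_sign_def flip: power_mult_distrib mult.assoc)

text \<open>Deleting \<open>i\<close> and \<open>j\<close> in either order leads to the same face
  with opposite signs, because the presence of the smaller vertex shifts the position of the larger
  one.\<close>

lemma face_sign_exchange:
  assumes "finite B" "i \<notin> B" "j \<notin> B" "i \<noteq> j"
  shows "face_sign j (insert i B) * face_sign i B = - (face_sign i (insert j B) * face_sign j B)"
  using assms by (cases i j rule: linorder_cases) (auto simp: face_sign_insert)

text \<open>The same sign rule in the shape that the cone construction produces.\<close>

lemma face_sign_insert_mult:
  assumes "finite B" "i \<notin> B" "j \<notin> B" "i \<noteq> j"
  shows "face_sign j (insert i B) * face_sign i (insert j B) = - (face_sign j B * face_sign i B)"
  using assms by (cases i j rule: linorder_cases) (auto simp: face_sign_insert)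

lemma bd_add: "bd V (\<lambda>A. f A + g A) = (\<lambda>A. bd V f A + bd V g A)"
  by (auto simp: bd_def sum.distrib algebra_simps)

lemma bd_diff: "bd V (\<lambda>A. f A - g A) = (\<lambda>A. bd V f A - bd V g A)"
  by (auto simp: bd_def sum_subtractf algebra_simps)

lemma bd_nonzeroE:
  assumes "bd V f B \<noteq> 0"
  obtains i where "i \<in> V - B" "f (insert i B) \<noteq> 0"
proof -
  obtain i where "i \<in> V - B" "f (insert i B) * face_sign i B \<noteq> 0"
    using assms unfolding bd_def by (meson sum.not_neutral_contains_not_neutral)
  then show ?thesis
    using that by fastforce
qed

lemma chainD:
  assumes "chain \<Gamma> j f" "f A \<noteq> 0"
  shows "A \<in> \<Gamma>" "card A = j"
  using assms by (auto simp: chain_def)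

lemma chain_subset: "chain \<Gamma> j f \<Longrightarrow> A \<notin> \<Gamma> \<Longrightarrow> f A = 0"
  by (auto simp: chain_def)

lemma chain_bd:
  assumes "chain \<Gamma> (Suc j) f" "\<Gamma> \<subseteq> Pow V" "finite V" "down_closed \<Gamma>"
  shows "chain \<Gamma> j (bd V f)"
  unfolding chain_def
proof (intro allI impI)
  fix B assume "bd V f B \<noteq> 0"
  then obtain i where i: "i \<in> V - B" "f (insert i B) \<noteq> 0"
    by (rule bd_nonzeroE)
  then have "insert i B \<in> \<Gamma>" and c: "card (insert i B) = Suc j"
    using assms(1) by (auto simp: chain_def)
  then have "B \<in> \<Gamma>" "finite (insert i B)"
    using assms by (auto simp: down_closed_def intro: finite_subset)
  then show "B \<in> \<Gamma> \<and> card B = j"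
    using c i by auto
qed

text \<open>The double sum runs over ordered pairs of added vertices and is antisymmetric. Splitting
  it by the order of the two vertices avoids a division by two, so the argument works over every
  commutative ring.\<close>

lemma bd_bd:
  assumes "finite V" "\<And>A. f A \<noteq> 0 \<Longrightarrow> A \<subseteq> V"
  shows "bd V (bd V f) C = 0"
proof (cases "C \<subseteq> V")
  case True
  define W where "W = V - C"
  have fin: "finite C" "finite W"
    using True assms(1) finite_subset by (auto simp: W_def)
  define g where "g i j = f (insert j (insert i C)) * (face_sign j (insert i C) * face_sign i C)" for i j
  have anti: "g i j = - g j i" if "i \<in> W" "j \<in> W" "i \<noteq> j" for i j
    using face_sign_exchange[OF fin(1), of i j, where 'a = 'a] that
    by (simp add: g_def W_def insert_commute[of i j])
  have "bd V (bd V f) C = (\<Sum>i\<in>W. \<Sum>j\<in>W - {i}. g i j)"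
  proof -
    have "V - insert i C = W - {i}" for i
      by (auto simp: W_def)
    then show ?thesis
      unfolding bd_def W_def[symmetric] by (simp only: g_def sum_distrib_right mult.assoc)
  qed
  also have "\<dots> = (\<Sum>i\<in>W. (\<Sum>j\<in>{j\<in>W. i < j}. g i j) + (\<Sum>j\<in>{j\<in>W. j < i}. g i j))"
  proof (rule sum.cong[OF refl])
    fix i assume "i \<in> W"
    have "W - {i} = {j\<in>W. i < j} \<union> {j\<in>W. j < i}"
      by auto
    moreover have "{j\<in>W. i < j} \<inter> {j\<in>W. j < i} = {}"
      by auto
    ultimately show
      "(\<Sum>j\<in>W - {i}. g i j) = (\<Sum>j\<in>{j\<in>W. i < j}. g i j) + (\<Sum>j\<in>{j\<in>W. j < i}. g i j)"
      using fin(2) by (simp add: sum.union_disjoint)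
  qed
  also have "\<dots> = (\<Sum>i\<in>W. \<Sum>j\<in>{j\<in>W. i < j}. g i j) + (\<Sum>i\<in>W. \<Sum>j\<in>{j\<in>W. j < i}. g i j)"
    by (simp add: sum.distrib)
  \<comment> \<open>Exchanging the two summations turns the half with \<open>j < i\<close> into
    minus the other half.\<close>
  also have "(\<Sum>i\<in>W. \<Sum>j\<in>{j\<in>W. j < i}. g i j) = (\<Sum>j\<in>W. \<Sum>i\<in>{i\<in>W. j < i}. g i j)"
    by (rule sum.swap_restrict[OF fin(2) fin(2)])
  also have "\<dots> = (\<Sum>j\<in>W. \<Sum>i\<in>{i\<in>W. j < i}. - g j i)"
    by (rule sum.cong[OF refl], rule sum.cong[OF refl], rule anti) auto
  finally show ?thesis
    by (simp add: sum_negf)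
next
  case False
  then have "f (insert j (insert i C)) = 0" for i j
    using assms(2) by blast
  then show ?thesis
    by (simp add: bd_def)
qed

section \<open>Cones and the acyclicity of simplices\<close>

text \<open>The cone adds \<open>w\<close> to every face not containing it and kills the faces that
  contain it. The sign cancels the one that arises when \<open>w\<close> is deleted again.\<close>

definition cone :: "nat \<Rightarrow> (nat set \<Rightarrow> 'k) \<Rightarrow> nat set \<Rightarrow> 'k::comm_ring_1" where
  "cone w f A = (if w \<in> A then face_sign w (A - {w}) * f (A - {w}) else 0)"

text \<open>Coning from \<open>w\<close> is a contracting homotopy of the full simplex on
  \<open>V\<close>. If \<open>w\<close> lies outside \<open>B\<close>, only the addition of
  \<open>w\<close> itself contributes; if \<open>w\<close> lies in \<open>B\<close>, the terms for
  the other vertices cancel in pairs.\<close>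

lemma bd_cone:
  assumes "finite V" "w \<in> V" "\<And>A. f A \<noteq> 0 \<Longrightarrow> A \<subseteq> V"
  shows "bd V (cone w f) B + cone w (bd V f) B = f B"
proof (cases "B \<subseteq> V")
  case False
  then have "f B = 0" "\<And>i. f (insert i B) = 0"
    using assms(3) by blast+
  \<comment> \<open>Deleting \<open>w\<close>, which lies in \<open>V\<close>, cannot bring
    \<open>B\<close> inside \<open>V\<close>, so every value of \<open>f\<close> involved is
    0.\<close>
  moreover have "\<not> insert i B - {w} \<subseteq> V" "\<not> insert i (B - {w}) \<subseteq> V" for i
    using assms(2) False by auto
  then have "f (insert i B - {w}) = 0" and "f (insert i (B - {w})) = 0" for i
    using assms(3) by blast+
  then have "cone w f (insert i B) = 0" and "f (insert i (B - {w})) = 0" for i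
    unfolding cone_def by (simp_all only: mult_zero_right if_cancel)
  ultimately have "bd V (cone w f) B = 0" "bd V f (B - {w}) = 0" "f B = 0"
    by (simp_all only: bd_def mult_zero_left sum.neutral_const)
  then show ?thesis
    by (simp add: cone_def)
next
  case True
  then have finB: "finite B"
    using assms(1) finite_subset by blast
  show ?thesis
  proof (cases "w \<in> B")
    case False
    have "bd V (cone w f) B = (\<Sum>i\<in>V - B. if i = w then f B else 0)"
      unfolding bd_def using False face_sign_cancel[of w B "f B"]
      by (intro sum.cong refl) (auto simp: cone_def mult.commute)
    then show ?thesis
      using False assms(1,2) by (simp add: cone_def)
  next
    case w: True
    define B' where "B' = B - {w}"
    have B: "B = insert w B'" "w \<notin> B'" "finite B'"
      using w finB by (auto simp: B'_def)
    \<comment> \<open>Adding \<open>w\<close> to \<open>B'\<close> gives back \<open>f B\<close>;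
      the remaining vertices produce the terms that cancel.\<close>
    have V_B': "V - B' = insert w (V - B)"
      using assms(2) w by (auto simp: B'_def)
    have "cone w (bd V f) B = face_sign w B' * (\<Sum>i\<in>V - B'. f (insert i B') * face_sign i B')"
      using w by (simp add: cone_def bd_def B'_def)
    also have "\<dots> =
        face_sign w B' * (f B * face_sign w B' + (\<Sum>i\<in>V - B. f (insert i B') * face_sign i B'))"
      unfolding V_B' using w assms(1) by (simp flip: B(1))
    also have "\<dots> = f B + (\<Sum>i\<in>V - B. face_sign w B' * (f (insert i B') * face_sign i B'))"
      using face_sign_cancel[of w B' "f B"]
      by (simp add: sum_distrib_left distrib_left mult.commute[of "f B"])
    also have "(\<Sum>i\<in>V - B. face_sign w B' * (f (insert i B') * face_sign i B')) =
        - (\<Sum>i\<in>V - B. cone w f (insert i B) * face_sign i B)"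
      unfolding sum_negf[symmetric]
    proof (intro sum.cong refl)
      fix i assume i: "i \<in> V - B"
      then have "insert i B - {w} = insert i B'" "i \<noteq> w" "i \<notin> B'"
        using B w by auto
      then have "cone w f (insert i B) * face_sign i B =
          f (insert i B') * (face_sign w (insert i B') * face_sign i (insert w B'))"
        using w B(1) by (simp add: cone_def mult_ac)
      also have "\<dots> = - (face_sign w B' * (f (insert i B') * face_sign i B'))"
        using face_sign_insert_mult[OF B(3) \<open>i \<notin> B'\<close> B(2) \<open>i \<noteq> w\<close>, where 'a = 'a]
        by (simp add: mult_ac)
      finally show "face_sign w B' * (f (insert i B') * face_sign i B') =
          - (cone w f (insert i B) * face_sign i B)"
        by simp
    qed
    finally show ?thesis
      by (simp add: bd_def[of V "cone w f"])
  qed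
qed

text \<open>The part of a cycle outside \<open>\<Gamma>\<close> lives on the simplex \<open>F\<close>, and coning it off from \<open>w\<close> pushes
  the cycle into \<open>\<Gamma>\<close>. For \<open>\<Gamma> = {}\<close> this is the acyclicity of a simplex.\<close>

lemma exact_at_attach_simplex:
  fixes V F :: "nat set"
  assumes V: "finite V" "\<Gamma> \<union> Pow F \<subseteq> Pow V" and "down_closed \<Gamma>" and "w \<in> F"
    and cone_in: "\<And>A. A \<in> \<Gamma> \<Longrightarrow> A \<subseteq> F \<Longrightarrow> insert w A \<in> \<Gamma>"
    and exact: "exact_at TYPE('k::comm_ring_1) V \<Gamma> j"
  shows "exact_at TYPE('k) V (\<Gamma> \<union> Pow F) j"
  unfolding exact_at_def
proof (intro allI impI, elim conjE)
  fix f :: "nat set \<Rightarrow> 'k"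
  assume f: "chain (\<Gamma> \<union> Pow F) j f" and cycle: "bd V f = (\<lambda>_. 0)"
  \<comment> \<open>\<open>b\<close> is the part of the cycle on faces outside \<Gamma>, hence
    inside \<open>F\<close>, and \<open>a\<close> is the part already in \<Gamma>.\<close>
  define b where "b A = (if A \<in> \<Gamma> then 0 else f A)" for A
  define a where "a A = (if A \<in> \<Gamma> then f A else 0)" for A
  have w: "w \<in> V"
    using V(2) \<open>w \<in> F\<close> by auto
  have b: "chain (Pow F) j b"
    using f by (auto simp: chain_def b_def)
  have "F \<subseteq> V"
    using V(2) by auto
  then have finF: "finite A" if "A \<subseteq> F" for A
    using V(1) that by (meson finite_subset)
  have b_V: "b A \<noteq> 0 \<Longrightarrow> A \<subseteq> V" for A
    using chain_subset[OF b] \<open>F \<subseteq> V\<close> by blast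
  have a: "chain \<Gamma> j a"
    using f by (auto simp: chain_def a_def)
  have f_ab: "f = (\<lambda>A. a A + b A)"
    by (auto simp: a_def b_def)
  \<comment> \<open>Because of the cycle condition the boundary of \<open>b\<close> lives both on
    \<Gamma> and on \<open>F\<close>, which is what \<open>cone_in\<close> needs.\<close>
  have bd_ab: "bd V b A = - bd V a A" for A
    using fun_cong[OF cycle, of A] unfolding f_ab bd_add by (simp add: add_eq_0_iff)
  define g where "g = cone w b"
  have g: "chain (Pow F) (Suc j) g"
    unfolding chain_def
  proof (intro allI impI)
    fix A assume "g A \<noteq> 0"
    then have "w \<in> A" "b (A - {w}) \<noteq> 0"
      by (auto simp: g_def cone_def split: if_splits)
    then have *: "A - {w} \<subseteq> F" "card (A - {w}) = j"
      using b by (auto simp: chain_def)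
    then have "A \<subseteq> F"
      using \<open>w \<in> F\<close> by blast
    then show "A \<in> Pow F \<and> card A = Suc j"
      using *(2) card_Suc_Diff1[OF finF \<open>w \<in> A\<close>] by simp
  qed
  \<comment> \<open>A homologous cycle in which the part outside \<Gamma> is replaced by the cone
    over its boundary.\<close>
  define f' where "f' A = f A - bd V g A" for A
  have f'_eq: "f' A = a A + cone w (bd V b) A" for A
  proof -
    have "b A = bd V g A + cone w (bd V b) A"
      unfolding g_def by (rule bd_cone[OF V(1) w, symmetric]) (rule b_V)
    then show ?thesis
      using fun_cong[OF f_ab, of A] by (simp add: f'_def)
  qed
  have bd_g: "chain (Pow F) j (bd V g)"
    using g V by (intro chain_bd) (auto simp: down_closed_def)
  have "chain \<Gamma> j f'"
    unfolding chain_def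
  proof (intro allI impI)
    fix A assume A: "f' A \<noteq> 0"
    have "A \<in> \<Gamma>"
    proof (rule ccontr)
      assume "A \<notin> \<Gamma>"
      then have "cone w (bd V b) A \<noteq> 0"
        using A by (simp add: f'_eq a_def)
      then have "w \<in> A" and nz: "bd V b (A - {w}) \<noteq> 0"
        by (auto simp: cone_def split: if_splits)
      have "A - {w} \<in> \<Gamma>"
      proof -
        have "bd V a (A - {w}) \<noteq> 0"
          using nz bd_ab[of "A - {w}"] by simp
        then obtain i where "a (insert i (A - {w})) \<noteq> 0"
          by (rule bd_nonzeroE)
        then show ?thesis
          using a \<open>down_closed \<Gamma>\<close> unfolding down_closed_def chain_def by (meson subset_insertI)
      qed
      moreover have "A - {w} \<subseteq> F"
      proof -
        obtain i where "b (insert i (A - {w})) \<noteq> 0"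
          using nz by (rule bd_nonzeroE)
        then show ?thesis
          using b by (auto simp: chain_def)
      qed
      ultimately have "insert w (A - {w}) \<in> \<Gamma>"
        by (rule cone_in)
      then show False
        using \<open>A \<notin> \<Gamma>\<close> \<open>w \<in> A\<close> by (simp add: insert_absorb)
    qed
    moreover have "card A = j"
    proof -
      have "f A \<noteq> 0 \<or> bd V g A \<noteq> 0"
        using A by (auto simp: f'_def)
      then show ?thesis
        using chainD(2)[OF f] chainD(2)[OF bd_g] by blast
    qed
    ultimately show "A \<in> \<Gamma> \<and> card A = j" ..
  qed
  moreover have "bd V f' = (\<lambda>_. 0)"
  proof -
    have "f' = (\<lambda>A. f A - bd V g A)"
      by (simp add: f'_def fun_eq_iff)
    then have "bd V f' A = bd V f A - bd V (bd V g) A" for A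
      by (simp only: bd_diff)
    moreover have "bd V (bd V g) A = 0" for A
      using chainD(1)[OF g] \<open>F \<subseteq> V\<close> by (intro bd_bd[OF V(1)]) blast
    ultimately have "bd V f' A = 0" for A
      by (simp only: cycle) simp
    then show ?thesis
      by (rule ext)
  qed
  ultimately obtain g' where g': "chain \<Gamma> (Suc j) g'" "bd V g' = f'"
    using exact unfolding exact_at_def by blast
  show "\<exists>g. chain (\<Gamma> \<union> Pow F) (Suc j) g \<and> bd V g = f"
  proof (intro exI conjI)
    show "chain (\<Gamma> \<union> Pow F) (Suc j) (\<lambda>A. g A + g' A)"
      unfolding chain_def
    proof (intro allI impI)
      fix A assume "g A + g' A \<noteq> 0"
      then have "g A \<noteq> 0 \<or> g' A \<noteq> 0"
        by auto
      then show "A \<in> \<Gamma> \<union> Pow F \<and> card A = Suc j"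
        using g g'(1) by (auto simp: chain_def)
    qed
    show "bd V (\<lambda>A. g A + g' A) = f"
      by (simp only: bd_add g'(2)) (simp add: f'_def)
  qed
qed

lemma exact_at_simplex:
  assumes "finite V" "F \<subseteq> V" "F \<noteq> {}"
  shows "exact_at TYPE('k::comm_ring_1) V (Pow F) j"
proof -
  obtain w where "w \<in> F"
    using assms(3) by blast
  have "exact_at TYPE('k) V {} j"
    by (auto simp: exact_at_def chain_def bd_def fun_eq_iff)
  then have "exact_at TYPE('k) V ({} \<union> Pow F) j"
    using assms \<open>w \<in> F\<close> by (intro exact_at_attach_simplex) (auto simp: down_closed_def)
  then show ?thesis
    by simp
qed

lemma exact_at_empty_face: "exact_at TYPE('k::comm_ring_1) V {{}} (Suc j)"
  unfolding exact_at_def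
proof (intro allI impI, elim conjE)
  fix f :: "nat set \<Rightarrow> 'k"
  assume "chain {{}} (Suc j) f"
  then have "f = (\<lambda>_. 0)"
    by (fastforce simp: chain_def)
  then have "chain {{}} (Suc (Suc j)) f \<and> bd V f = f"
    by (simp add: chain_def bd_def fun_eq_iff)
  then show "\<exists>g. chain {{}} (Suc (Suc j)) g \<and> bd V g = f"
    by blast
qed

section \<open>Simplicial trees are acyclic\<close>

text \<open>Common to the simplicial and the labeled boundary; \<open>h\<close> stands for the
  coefficient that each attaches. The pairs with \<open>i\<close> in \<open>A\<close> and
  \<open>A - {i} = B\<close> correspond to the vertices outside \<open>B\<close>, and
  \<open>h A i 0 = 0\<close> permits summing over all subsets of \<open>V\<close>.\<close>

lemma lookup_sum_boundary_terms:
  fixes c :: "nat set \<Rightarrow>\<^sub>0 'a::comm_monoid_add" and h :: "nat set \<Rightarrow> nat \<Rightarrow> 'a \<Rightarrow> 'b::comm_monoid_add"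
  assumes "finite V" "Poly_Mapping.keys c \<subseteq> Pow V" "\<And>A i. h A i 0 = 0"
  shows "Poly_Mapping.lookup (\<Sum>A\<in>Poly_Mapping.keys c. \<Sum>i\<in>A.
            Poly_Mapping.single (A - {i}) (h A i (Poly_Mapping.lookup c A))) B =
         (\<Sum>i\<in>V - B. h (insert i B) i (Poly_Mapping.lookup c (insert i B)))"
    (is "?L = _")
proof -
  define x where "x A i = h A i (Poly_Mapping.lookup c A)" for A i
  have x0: "x A i = 0" if "A \<notin> Poly_Mapping.keys c" for A i
    using that assms(3) by (simp add: x_def in_keys_iff)
  have "?L = (\<Sum>A\<in>Poly_Mapping.keys c. \<Sum>i\<in>A. if A - {i} = B then x A i else 0)"
    unfolding x_def by (simp add: lookup_sum lookup_single when_def)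
  also have "\<dots> = (\<Sum>A\<in>Pow V. \<Sum>i\<in>A. if A - {i} = B then x A i else 0)"
    using assms(1,2) x0 by (intro sum.mono_neutral_left) (auto intro!: sum.neutral)
  also have "\<dots> = (\<Sum>A\<in>Pow V. \<Sum>i\<in>V. if i \<in> A \<and> A - {i} = B then x A i else 0)"
  proof (rule sum.cong[OF refl])
    fix A assume "A \<in> Pow V"
    then have "(\<Sum>i\<in>V. if i \<in> A \<and> A - {i} = B then x A i else 0) =
        (\<Sum>i\<in>A. if i \<in> A \<and> A - {i} = B then x A i else 0)"
      using assms(1) by (intro sum.mono_neutral_right) auto
    then show "(\<Sum>i\<in>A. if A - {i} = B then x A i else 0) =
        (\<Sum>i\<in>V. if i \<in> A \<and> A - {i} = B then x A i else 0)"
      by simp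
  qed
  also have "\<dots> = (\<Sum>i\<in>V. \<Sum>A\<in>Pow V. if i \<in> A \<and> A - {i} = B then x A i else 0)"
    by (rule sum.swap)
  also have "\<dots> = (\<Sum>i\<in>V. if i \<in> B then 0 else x (insert i B) i)"
  proof (rule sum.cong[OF refl])
    fix i assume "i \<in> V"
    show "(\<Sum>A\<in>Pow V. if i \<in> A \<and> A - {i} = B then x A i else 0) =
        (if i \<in> B then 0 else x (insert i B) i)"
    proof (cases "i \<in> B")
      case True
      then show ?thesis
        by (auto intro!: sum.neutral)
    next
      case False
      then have "(if i \<in> A \<and> A - {i} = B then x A i else 0) =
          (if A = insert i B then x (insert i B) i else 0)" for A
        by auto
      then have "(\<Sum>A\<in>Pow V. if i \<in> A \<and> A - {i} = B then x A i else 0) =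
          (if insert i B \<in> Pow V then x (insert i B) i else 0)"
        using assms(1) by (simp only: sum.delta finite_Pow_iff)
      then show ?thesis
        using False x0[of "insert i B" i] assms(2) by auto
    qed
  qed
  also have "\<dots> = (\<Sum>i\<in>V - B. x (insert i B) i)"
    using assms(1) by (intro sum.mono_neutral_cong_right) auto
  finally show ?thesis
    by (simp only: x_def)
qed

lemma lookup_simplicial_boundary:
  assumes "finite V" "Poly_Mapping.keys c \<subseteq> Pow V"
  shows "Poly_Mapping.lookup (simplicial_boundary c) = bd V (Poly_Mapping.lookup c)"
proof
  fix B
  show "Poly_Mapping.lookup (simplicial_boundary c) B = bd V (Poly_Mapping.lookup c) B"
    unfolding simplicial_boundary_def bd_def
    using lookup_sum_boundary_terms[OF assms, of "\<lambda>A i y. y * face_sign i A" B]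
    by (simp add: face_sign_insert_self)
qed

lemma lookup_chain:
  assumes "finite \<Gamma>" "chain \<Gamma> j f"
  shows "Poly_Mapping.lookup (Abs_poly_mapping f) = f"
proof -
  have "finite {A. f A \<noteq> 0}"
    by (rule finite_subset[OF _ assms(1)]) (use assms(2) in \<open>auto simp: chain_def\<close>)
  then show ?thesis
    by simp
qed

lemma reduced_chains_iff: "c \<in> reduced_chains \<Gamma> j \<longleftrightarrow> chain \<Gamma> j (Poly_Mapping.lookup c)"
  by (auto simp: reduced_chains_def chain_def in_keys_iff)

text \<open>Boundaries are always cycles, so only the inclusion in \<open>exact_at\<close> carries
  information. Finiteness of \<Gamma> turns functions back into finitely supported chains.\<close>

lemma acyclic_over_iff:
  assumes "finite V" "\<Gamma> \<subseteq> Pow V" "down_closed \<Gamma>"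
  shows "acyclic_over TYPE('k::field) \<Gamma> \<longleftrightarrow> (\<forall>j. exact_at TYPE('k) V \<Gamma> j)"
proof -
  have fin: "finite \<Gamma>"
    using assms(1,2) finite_subset by blast
  have V: "Poly_Mapping.keys c \<subseteq> Pow V" if "c \<in> reduced_chains \<Gamma> j" for c :: "nat set \<Rightarrow>\<^sub>0 'k" and j
    using that assms(2) by (auto simp: reduced_chains_def)
  have lookup: "Poly_Mapping.lookup (simplicial_boundary c) = bd V (Poly_Mapping.lookup c)"
    if "c \<in> reduced_chains \<Gamma> j" for c :: "nat set \<Rightarrow>\<^sub>0 'k" and j
    using lookup_simplicial_boundary[OF assms(1) V[OF that]] .
  have sub: "simplicial_boundary ` reduced_chains \<Gamma> (Suc j) \<subseteq>
      {c \<in> reduced_chains \<Gamma> j. simplicial_boundary c = (0 :: nat set \<Rightarrow>\<^sub>0 'k)}" for j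
  proof clarify
    fix d :: "nat set \<Rightarrow>\<^sub>0 'k" assume d: "d \<in> reduced_chains \<Gamma> (Suc j)"
    let ?c = "simplicial_boundary d"
    have c: "?c \<in> reduced_chains \<Gamma> j"
      using d assms lookup[OF d] by (simp add: reduced_chains_iff chain_bd)
    moreover have "Poly_Mapping.lookup (simplicial_boundary ?c) B = 0" for B
      unfolding lookup[OF c] lookup[OF d]
      by (rule bd_bd[OF assms(1)]) (use V[OF d] in \<open>auto simp: in_keys_iff\<close>)
    then have "simplicial_boundary ?c = 0"
      by (intro poly_mapping_eqI) simp
    ultimately show "?c \<in> reduced_chains \<Gamma> j \<and> simplicial_boundary ?c = 0"
      by simp
  qed
  have "{c \<in> reduced_chains \<Gamma> j. simplicial_boundary c = (0 :: nat set \<Rightarrow>\<^sub>0 'k)} \<subseteq>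
      simplicial_boundary ` reduced_chains \<Gamma> (Suc j) \<longleftrightarrow> exact_at TYPE('k) V \<Gamma> j" for j
  proof
    assume *: "{c \<in> reduced_chains \<Gamma> j. simplicial_boundary c = (0 :: nat set \<Rightarrow>\<^sub>0 'k)} \<subseteq>
      simplicial_boundary ` reduced_chains \<Gamma> (Suc j)"
    show "exact_at TYPE('k) V \<Gamma> j"
      unfolding exact_at_def
    proof (intro allI impI, elim conjE)
      fix f :: "nat set \<Rightarrow> 'k"
      assume f: "chain \<Gamma> j f" "bd V f = (\<lambda>_. 0)"
      define c where "c = Abs_poly_mapping f"
      have lc: "Poly_Mapping.lookup c = f"
        unfolding c_def by (rule lookup_chain[OF fin f(1)])
      then have c: "c \<in> reduced_chains \<Gamma> j"
        using f(1) by (simp add: reduced_chains_iff)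
      moreover have "simplicial_boundary c = 0"
        using f(2) by (intro poly_mapping_eqI) (simp add: lookup[OF c] lc)
      ultimately obtain d where d: "d \<in> reduced_chains \<Gamma> (Suc j)" "c = simplicial_boundary d"
        using * by blast
      then have "bd V (Poly_Mapping.lookup d) = f"
        using lookup[OF d(1)] lc by simp
      then show "\<exists>g. chain \<Gamma> (Suc j) g \<and> bd V g = f"
        using d(1) reduced_chains_iff by blast
    qed
  next
    assume exact: "exact_at TYPE('k) V \<Gamma> j"
    show "{c \<in> reduced_chains \<Gamma> j. simplicial_boundary c = (0 :: nat set \<Rightarrow>\<^sub>0 'k)} \<subseteq>
      simplicial_boundary ` reduced_chains \<Gamma> (Suc j)"
    proof clarify
      fix c :: "nat set \<Rightarrow>\<^sub>0 'k"
      assume c: "c \<in> reduced_chains \<Gamma> j" "simplicial_boundary c = 0"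
      then have "bd V (Poly_Mapping.lookup c) = (\<lambda>_. 0)"
        using lookup[OF c(1)] by (simp add: fun_eq_iff)
      then obtain g where g: "chain \<Gamma> (Suc j) g" "bd V g = Poly_Mapping.lookup c"
        using exact c(1) unfolding exact_at_def reduced_chains_iff by blast
      define d where "d = Abs_poly_mapping g"
      have ld: "Poly_Mapping.lookup d = g"
        unfolding d_def by (rule lookup_chain[OF fin g(1)])
      then have d: "d \<in> reduced_chains \<Gamma> (Suc j)"
        using g(1) by (simp add: reduced_chains_iff)
      have "c = simplicial_boundary d"
        by (rule poly_mapping_eqI) (simp add: lookup[OF d] ld g(2))
      then show "c \<in> simplicial_boundary ` reduced_chains \<Gamma> (Suc j)"
        using d by blast
    qed
  qed
  then show ?thesis
    unfolding acyclic_over_def using sub by (simp add: set_eq_subset)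
qed

section \<open>Facets, leaves and induction over trees\<close>

text \<open>Through this, a leaf of a generated complex is known to be a member of the generating
  antichain.\<close>

lemma facets_complex_generated_by:
  assumes "\<And>F G. F \<in> \<F> \<Longrightarrow> G \<in> \<F> \<Longrightarrow> F \<subseteq> G \<Longrightarrow> F = G"
  shows "facets (complex_generated_by \<F>) = \<F>"
proof (intro equalityI subsetI)
  fix F assume F: "F \<in> facets (complex_generated_by \<F>)"
  then obtain H where H: "H \<in> \<F>" "F \<subseteq> H"
    by (auto simp: facets_def complex_generated_by_def)
  then have "H \<in> complex_generated_by \<F>"
    by (auto simp: complex_generated_by_def)
  then have "H = F"
    using F H(2) by (simp add: facets_def)
  then show "F \<in> \<F>"
    using H(1) by simp
next
  fix F assume F: "F \<in> \<F>"
  have "G = F" if "H \<in> \<F>" "G \<subseteq> H" "F \<subseteq> G" for G H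
    using assms[OF F that(1)] that(2,3) by auto
  then show "F \<in> facets (complex_generated_by \<F>)"
    using F by (auto simp: facets_def complex_generated_by_def)
qed

lemma down_closed_complex_generated_by: "down_closed (complex_generated_by \<F>)"
  by (auto simp: down_closed_def complex_generated_by_def)

lemma complex_generated_by_insert:
  "complex_generated_by (insert F \<F>) = complex_generated_by \<F> \<union> Pow F"
  by (auto simp: complex_generated_by_def)

text \<open>If \<open>F\<close> and \<open>G\<close> were disjoint, the branch condition would make
  \<open>F\<close> disjoint from every other facet, and an edge path could never leave
  \<open>F\<close>.\<close>

lemma leaf_meets_branch:
  assumes conn: "connected_complex (\<Union>(insert F \<F>)) (complex_generated_by (insert F \<F>))"
    and ne: "F \<noteq> {}" "G \<noteq> {}" "G \<in> \<F>"
    and branch: "\<And>H. H \<in> \<F> \<Longrightarrow> F \<inter> H \<subseteq> G"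
  shows "F \<inter> G \<noteq> {}"
proof
  assume disj: "F \<inter> G = {}"
  obtain u v where uv: "u \<in> F" "v \<in> G"
    using ne by blast
  then have "(u, v) \<in> {(a, b). {a, b} \<in> complex_generated_by (insert F \<F>)}\<^sup>*"
    using conn ne(3) unfolding connected_complex_def by blast
  then have "v \<in> F"
  proof (induction rule: rtrancl_induct)
    case (step a b)
    then obtain H where "H = F \<or> H \<in> \<F>" "{a, b} \<subseteq> H"
      by (auto simp: complex_generated_by_def)
    then show ?case
      using step.IH branch[of H] disj by auto
  qed (rule uv(1))
  then show False
    using uv(2) disj by blast
qed

text \<open>Mapping the vertices that lie only in the leaf \<open>F\<close> to a vertex \<open>w\<close> shared with the branch
  \<open>G\<close> sends edge paths to edge paths.\<close>

lemma connected_remove_leaf: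
  assumes conn: "connected_complex (\<Union>(insert F \<F>)) (complex_generated_by (insert F \<F>))"
    and G: "G \<in> \<F>" "\<And>H. H \<in> \<F> \<Longrightarrow> F \<inter> H \<subseteq> G"
    and w: "w \<in> F" "w \<in> G"
  shows "connected_complex (\<Union>\<F>) (complex_generated_by \<F>)"
  unfolding connected_complex_def
proof (intro ballI)
  fix u v assume uv: "u \<in> \<Union>\<F>" "v \<in> \<Union>\<F>"
  define r where "r x = (if x \<in> \<Union>\<F> then x else w)" for x
  let ?E = "{(a, b). {a, b} \<in> complex_generated_by \<F>}"
  have "(u, v) \<in> {(a, b). {a, b} \<in> complex_generated_by (insert F \<F>)}\<^sup>*"
    using conn uv unfolding connected_complex_def by blast
  then have "(r u, r v) \<in> ?E\<^sup>*"
  proof (induction rule: rtrancl_induct)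
    case (step a b)
    then obtain H where H: "H = F \<or> H \<in> \<F>" "a \<in> H" "b \<in> H"
      by (auto simp: complex_generated_by_def)
    have "\<exists>H'\<in>\<F>. {r a, r b} \<subseteq> H'"
    proof (cases "H \<in> \<F>")
      case True
      then show ?thesis
        using H by (auto simp: r_def)
    next
      case False
      \<comment> \<open>The edge lies in the leaf: a vertex shared with another facet is in
        \<open>G\<close> by the branch condition, and every other vertex is sent to
        \<open>w\<close>.\<close>
      then have "r x \<in> G" if "x \<in> {a, b}" for x
        using that H G w by (auto simp: r_def)
      then show ?thesis
        using G(1) by blast
    qed
    then have "(r a, r b) \<in> ?E"
      by (simp add: complex_generated_by_def)
    with step.IH show ?case
      by (rule rtrancl_into_rtrancl)
  qed simp
  then show "(u, v) \<in> ?E\<^sup>*"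
    using uv by (simp add: r_def)
qed

text \<open>Induction over the set of facets, removing a leaf; the ambient \<open>V\<close> stays
  fixed while the vertex set shrinks. Excluding the empty facet rules out \<open>{{}}\<close>, which
  is not acyclic.\<close>

lemma exact_at_tree:
  assumes "finite \<F>" "\<F> \<noteq> {}" "finite V" "\<Union>\<F> \<subseteq> V" "{} \<notin> \<F>"
    and "\<And>F G. F \<in> \<F> \<Longrightarrow> G \<in> \<F> \<Longrightarrow> F \<subseteq> G \<Longrightarrow> F = G"
    and "\<And>\<G>. \<G> \<subseteq> \<F> \<Longrightarrow> \<G> \<noteq> {} \<Longrightarrow> \<exists>F. leaf (complex_generated_by \<G>) F"
    and "connected_complex (\<Union>\<F>) (complex_generated_by \<F>)"
  shows "exact_at TYPE('k::comm_ring_1) V (complex_generated_by \<F>) j"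
  using assms
proof (induction \<F> rule: finite_psubset_induct)
  case (psubset \<F>)
  have antichain: "F \<in> \<F> \<Longrightarrow> G \<in> \<F> \<Longrightarrow> F \<subseteq> G \<Longrightarrow> F = G" for F G
    by (rule psubset.prems(5))
  obtain F where "leaf (complex_generated_by \<F>) F"
    using psubset.prems(6)[OF order_refl psubset.prems(1)] ..
  moreover have facets: "facets (complex_generated_by \<F>) = \<F>"
    using antichain by (rule facets_complex_generated_by)
  ultimately have F: "F \<in> \<F>"
    and branch: "\<F> = {F} \<or> (\<exists>G\<in>\<F>. G \<noteq> F \<and> (\<forall>H\<in>\<F>. H \<noteq> F \<longrightarrow> F \<inter> H \<subseteq> G))"
    by (auto simp: leaf_def)
  have "F \<noteq> {}" "F \<subseteq> V"
    using F psubset.prems by auto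
  show ?case
  proof (cases "\<F> = {F}")
    case True
    then have "complex_generated_by \<F> = Pow F"
      by (auto simp: complex_generated_by_def)
    then show ?thesis
      using exact_at_simplex[OF \<open>finite V\<close> \<open>F \<subseteq> V\<close> \<open>F \<noteq> {}\<close>] by simp
  next
    case False
    define \<F>' where "\<F>' = \<F> - {F}"
    have \<F>: "\<F> = insert F \<F>'" "\<F>' \<subset> \<F>"
      using F by (auto simp: \<F>'_def)
    obtain G where G: "G \<in> \<F>'" "\<And>H. H \<in> \<F>' \<Longrightarrow> F \<inter> H \<subseteq> G"
      using branch False by (auto simp: \<F>'_def)
    have "G \<noteq> {}"
      using G(1) psubset.prems(4) \<F>(2) by auto
    note conn = psubset.prems(7)[unfolded \<F>(1)]
    obtain w where w: "w \<in> F" "w \<in> G"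
      using leaf_meets_branch[OF conn \<open>F \<noteq> {}\<close> \<open>G \<noteq> {}\<close> G] by blast
    have "exact_at TYPE('k) V (complex_generated_by \<F>') j"
    proof (rule psubset.IH[OF \<F>(2)])
      show "\<F>' \<noteq> {}"
        using G(1) by blast
      show "finite V"
        by fact
      show "\<Union>\<F>' \<subseteq> V" "{} \<notin> \<F>'"
        using psubset.prems(3,4) \<F>(2) by blast+
      show "A \<in> \<F>' \<Longrightarrow> B \<in> \<F>' \<Longrightarrow> A \<subseteq> B \<Longrightarrow> A = B" for A B
        using \<F>(2) by (intro antichain) auto
      show "\<G> \<subseteq> \<F>' \<Longrightarrow> \<G> \<noteq> {} \<Longrightarrow> \<exists>F. leaf (complex_generated_by \<G>) F" for \<G>
        using \<F>(2) by (intro psubset.prems(6)) auto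
      show "connected_complex (\<Union>\<F>') (complex_generated_by \<F>')"
        using connected_remove_leaf[OF conn G w] .
    qed
    \<comment> \<open>Faces common to the leaf and the rest lie in \<open>F \<inter> G\<close>, a
      simplex containing \<open>w\<close>, so the leaf can be attached.\<close>
    moreover have "insert w A \<in> complex_generated_by \<F>'"
      if A: "A \<in> complex_generated_by \<F>'" "A \<subseteq> F" for A
    proof -
      obtain H where "H \<in> \<F>'" "A \<subseteq> H"
        using A(1) by (auto simp: complex_generated_by_def)
      then have "insert w A \<subseteq> G"
        using A(2) G(2)[of H] w(2) by blast
      then show ?thesis
        using G(1) by (auto simp: complex_generated_by_def)
    qed
    moreover have "complex_generated_by \<F>' \<union> Pow F \<subseteq> Pow V"
      using psubset.prems(3) \<F>(1) by (auto simp: complex_generated_by_def)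
    ultimately show ?thesis
      unfolding \<F>(1) complex_generated_by_insert
      by (intro exact_at_attach_simplex[OF \<open>finite V\<close> _ down_closed_complex_generated_by w(1)])
  qed
qed

lemma face_subset_facet:
  assumes "finite \<Delta>" "A \<in> \<Delta>"
  obtains F where "F \<in> facets \<Delta>" "A \<subseteq> F"
  using finite_has_maximal2[OF assms] by (auto simp: facets_def)

lemma complex_generated_by_facets:
  assumes "finite \<Delta>" "down_closed \<Delta>"
  shows "complex_generated_by (facets \<Delta>) = \<Delta>"
proof (intro equalityI subsetI)
  fix A assume "A \<in> complex_generated_by (facets \<Delta>)"
  then show "A \<in> \<Delta>"
    using assms(2) by (auto simp: complex_generated_by_def facets_def down_closed_def)
next
  fix A assume "A \<in> \<Delta>"
  then show "A \<in> complex_generated_by (facets \<Delta>)"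
    using face_subset_facet[OF assms(1)] by (metis (mono_tags, lifting) complex_generated_by_def mem_Collect_eq)
qed

lemma simplicial_complexD:
  assumes "simplicial_complex V \<Delta>"
  shows "finite V" "V \<noteq> {}" "\<Delta> \<subseteq> Pow V" "{} \<in> \<Delta>" "down_closed \<Delta>" "finite \<Delta>"
    "v \<in> V \<Longrightarrow> {v} \<in> \<Delta>"
  using assms finite_subset[of \<Delta> "Pow V"] by (auto simp: simplicial_complex_def down_closed_def)

lemma finite_face: "simplicial_complex V \<Delta> \<Longrightarrow> A \<in> \<Delta> \<Longrightarrow> finite A"
  using simplicial_complexD(1,3) by (metis PowD finite_subset subsetD)

text \<open>Every vertex lies in a facet, so the facets cover \<open>V\<close> and generate
  \<Delta>, and \<open>exact_at_tree\<close> applies to them.\<close>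

lemma simplicial_tree_acyclic:
  assumes "simplicial_tree V \<Delta>"
  shows "acyclic_over TYPE('k::field) \<Delta>"
proof -
  have sc: "simplicial_complex V \<Delta>"
    using assms by (simp add: simplicial_tree_def)
  note \<Delta> = simplicial_complexD[OF sc]
  have gen: "complex_generated_by (facets \<Delta>) = \<Delta>"
    using \<Delta> by (intro complex_generated_by_facets)
  have Union: "\<Union>(facets \<Delta>) = V"
  proof
    show "\<Union>(facets \<Delta>) \<subseteq> V"
      using \<Delta>(3) by (auto simp: facets_def)
    show "V \<subseteq> \<Union>(facets \<Delta>)"
      using face_subset_facet[OF \<Delta>(6,7)] by blast
  qed
  have "exact_at TYPE('k) V (complex_generated_by (facets \<Delta>)) j" for j
  proof (rule exact_at_tree)
    show "finite (facets \<Delta>)"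
      using \<Delta>(6) by (simp add: facets_def)
    show "facets \<Delta> \<noteq> {}"
      using Union \<Delta>(2) by blast
    show "finite V" "\<Union>(facets \<Delta>) \<subseteq> V"
      using \<Delta>(1) Union by auto
    obtain v where "v \<in> V"
      using \<Delta>(2) by blast
    then show "{} \<notin> facets \<Delta>"
      using \<Delta>(7)[of v] by (auto simp: facets_def)
    show "F \<in> facets \<Delta> \<Longrightarrow> G \<in> facets \<Delta> \<Longrightarrow> F \<subseteq> G \<Longrightarrow> F = G" for F G
      by (auto simp: facets_def)
    show "\<G> \<subseteq> facets \<Delta> \<Longrightarrow> \<G> \<noteq> {} \<Longrightarrow> \<exists>F. leaf (complex_generated_by \<G>) F" for \<G>
      using assms by (simp add: simplicial_tree_def)
    show "connected_complex (\<Union>(facets \<Delta>)) (complex_generated_by (facets \<Delta>))"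
      using assms by (simp add: simplicial_tree_def Union gen)
  qed
  then show ?thesis
    using acyclic_over_iff[OF \<Delta>(1,3,5), where 'k = 'k] by (simp add: gen)
qed

section \<open>Monomial ideals\<close>

lemma poly_mapping_sum_single:
  "(\<Sum>t\<in>Poly_Mapping.keys p. Poly_Mapping.single t (Poly_Mapping.lookup p t)) = p"
  by (rule poly_mapping_eqI)
    (auto simp: lookup_sum lookup_single when_def in_keys_iff)

text \<open>Multiplication by a term shifts exponents by \<open>u\<close>. Multiset subtraction is
  truncated, so the divisibility test excludes spurious coefficients.\<close>

lemma lookup_times_single:
  fixes p :: "'v multiset \<Rightarrow>\<^sub>0 'a::comm_semiring_1"
  shows "Poly_Mapping.lookup (p * Poly_Mapping.single u a) s =
    (if u \<subseteq># s then Poly_Mapping.lookup p (s - u) * a else 0)"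
proof -
  have eq: "t + u = s \<longleftrightarrow> u \<subseteq># s \<and> t = s - u" for t
    by (auto simp: subset_mset.le_diff_conv2)
  have "p * Poly_Mapping.single u a =
      (\<Sum>t\<in>Poly_Mapping.keys p. Poly_Mapping.single t (Poly_Mapping.lookup p t)) * Poly_Mapping.single u a"
    by (simp only: poly_mapping_sum_single)
  also have "\<dots> = (\<Sum>t\<in>Poly_Mapping.keys p. Poly_Mapping.single (t + u) (Poly_Mapping.lookup p t * a))"
    by (simp add: sum_distrib_right mult_single)
  finally have "Poly_Mapping.lookup (p * Poly_Mapping.single u a) s =
      (\<Sum>t\<in>Poly_Mapping.keys p. if t + u = s then Poly_Mapping.lookup p t * a else 0)"
    by (simp add: lookup_sum lookup_single when_def)
  also have "\<dots> = (\<Sum>t\<in>Poly_Mapping.keys p. if t = s - u then (if u \<subseteq># s then Poly_Mapping.lookup p t * a else 0) else 0)"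
    by (intro sum.cong refl) (auto simp: eq)
  also have "\<dots> = (if u \<subseteq># s then Poly_Mapping.lookup p (s - u) * a else 0)"
    by (auto simp: in_keys_iff)
  finally show ?thesis .
qed

lemma poly_ring_simps:
  "carrier (poly_ring X) = {p. \<forall>t\<in>Poly_Mapping.keys p. set_mset t \<subseteq> X}"
  "mult (poly_ring X) = (*)" "one (poly_ring X) = 1" "zero (poly_ring X) = 0" "add (poly_ring X) = (+)"
  by (simp_all add: poly_ring_def)

lemma carrier_poly_ring_add:
  assumes "p \<in> carrier (poly_ring X)" "q \<in> carrier (poly_ring X)"
  shows "p + q \<in> carrier (poly_ring X)"
  using assms keys_add[of p q] by (auto simp: poly_ring_simps(1))

lemma carrier_poly_ring_mult:
  assumes "p \<in> carrier (poly_ring X)" "q \<in> carrier (poly_ring X)"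
  shows "p * q \<in> carrier (poly_ring X)"
  unfolding poly_ring_simps(1)
proof (intro CollectI ballI)
  fix t assume "t \<in> Poly_Mapping.keys (p * q)"
  then obtain a b where "t = a + b" "a \<in> Poly_Mapping.keys p" "b \<in> Poly_Mapping.keys q"
    using keys_mult[of p q] by auto
  then show "set_mset t \<subseteq> X"
    using assms by (simp add: poly_ring_simps(1))
qed

lemma cring_poly_ring: "cring (poly_ring X :: ('v, 'k::field) mpoly ring)"
proof (rule cringI)
  show "abelian_group (poly_ring X :: ('v, 'k) mpoly ring)"
  proof (rule abelian_groupI; (simp only: poly_ring_simps(4,5) carrier_poly_ring_add)?)
    fix p :: "('v, 'k) mpoly" assume "p \<in> carrier (poly_ring X)"
    then have "- p \<in> carrier (poly_ring X)"
      by (simp add: poly_ring_simps(1) in_keys_iff)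
    then show "\<exists>q\<in>carrier (poly_ring X). q + p = 0"
      by (intro bexI[of _ "- p"]) simp_all
  qed (simp_all add: poly_ring_simps(1) add.assoc add.commute)
  show "comm_monoid (poly_ring X :: ('v, 'k) mpoly ring)"
    by (rule comm_monoidI; (simp only: poly_ring_simps(2,3) carrier_poly_ring_mult)?)
      (simp_all add: poly_ring_simps(1) mult.assoc mult.commute)
qed (simp add: poly_ring_simps(2,5) distrib_right)

text \<open>Membership is decided term by term: the right-hand side is an ideal containing the
  generators, and every term of such a polynomial is a multiple of one generator.\<close>

lemma genideal_monomials:
  fixes X :: "'v set"
  assumes M: "\<And>u. u \<in> M \<Longrightarrow> set_mset u \<subseteq> X"
  shows "genideal (poly_ring X) (monomial ` M) =
    {p \<in> carrier (poly_ring X :: ('v, 'k::field) mpoly ring).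
       \<forall>t\<in>Poly_Mapping.keys p. \<exists>u\<in>M. u \<subseteq># t}"
    (is "?I = ?J")
proof
  interpret cring "poly_ring X :: ('v, 'k) mpoly ring"
    by (rule cring_poly_ring)
  have carrier: "monomial ` M \<subseteq> (carrier (poly_ring X) :: ('v, 'k) mpoly set)"
    using M by (simp add: monomial_def poly_ring_simps(1) image_subset_iff)
  have mult_J: "p * q \<in> ?J" if p: "p \<in> ?J" and q: "q \<in> carrier (poly_ring X)"
    for p q :: "('v, 'k) mpoly"
  proof (intro CollectI conjI ballI)
    show "p * q \<in> carrier (poly_ring X)"
      using p q by (simp add: carrier_poly_ring_mult)
    fix t assume "t \<in> Poly_Mapping.keys (p * q)"
    then obtain a b where t: "t = a + b" "a \<in> Poly_Mapping.keys p"
      using keys_mult[of p q] by auto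
    then obtain u where "u \<in> M" "u \<subseteq># a"
      using p by blast
    then show "\<exists>u\<in>M. u \<subseteq># t"
      unfolding t(1) using subset_mset.order_trans[OF _ mset_subset_eq_add_left] by blast
  qed
  have "ideal ?J (poly_ring X :: ('v, 'k) mpoly ring)"
  proof (rule idealI[OF ring_axioms])
    show "subgroup ?J (add_monoid (poly_ring X :: ('v, 'k) mpoly ring))"
    proof (rule add.subgroupI)
      have "0 \<in> ?J"
        by (simp add: poly_ring_simps(1))
      then show "?J \<noteq> {}"
        by blast
      show "?J \<subseteq> carrier (poly_ring X)"
        by blast
      fix p :: "('v, 'k) mpoly" assume p: "p \<in> ?J"
      have minus: "- p \<in> ?J"
        using p by (simp add: poly_ring_simps(1) in_keys_iff)
      moreover have "\<ominus>\<^bsub>poly_ring X\<^esub> p = - p"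
        using p minus by (intro minus_equality) (simp_all add: poly_ring_simps(4,5))
      ultimately show "\<ominus>\<^bsub>poly_ring X\<^esub> p \<in> ?J"
        by simp
      fix q :: "('v, 'k) mpoly" assume q: "q \<in> ?J"
      have "p + q \<in> ?J"
        using p q carrier_poly_ring_add[of p X q] keys_add[of p q] by blast
      then show "p \<oplus>\<^bsub>poly_ring X\<^esub> q \<in> ?J"
        by (simp add: poly_ring_simps(5))
    qed
  next
    fix p q :: "('v, 'k) mpoly" assume "p \<in> ?J" "q \<in> carrier (poly_ring X)"
    then have "p * q \<in> ?J"
      by (rule mult_J)
    then show "q \<otimes>\<^bsub>poly_ring X\<^esub> p \<in> ?J" "p \<otimes>\<^bsub>poly_ring X\<^esub> q \<in> ?J"
      by (simp_all only: poly_ring_simps(2) mult.commute[of q])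
  qed
  then show "?I \<subseteq> ?J"
    by (rule genideal_minimal) (use carrier in \<open>auto simp: monomial_def\<close>)
  interpret I: ideal ?I "poly_ring X :: ('v, 'k) mpoly ring"
    using carrier by (rule genideal_ideal)
  show "?J \<subseteq> ?I"
  proof
    fix p :: "('v, 'k) mpoly" assume p: "p \<in> ?J"
    have single: "Poly_Mapping.single t (Poly_Mapping.lookup p t) \<in> ?I"
      if t: "t \<in> Poly_Mapping.keys p" for t
    proof -
      obtain u where u: "u \<in> M" "u \<subseteq># t"
        using p t by blast
      have "set_mset t \<subseteq> X"
        using p t by (simp add: poly_ring_simps(1))
      then have "set_mset (t - u) \<subseteq> X"
        using set_mset_mono[OF diff_subset_eq_self, of t u] by blast
      then have "Poly_Mapping.single (t - u) (Poly_Mapping.lookup p t) \<in> carrier (poly_ring X)"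
        by (simp add: poly_ring_simps(1))
      moreover have "monomial u \<in> ?I"
        using genideal_self[OF carrier] u(1) by blast
      ultimately have "Poly_Mapping.single (t - u) (Poly_Mapping.lookup p t) \<otimes>\<^bsub>poly_ring X\<^esub> monomial u \<in> ?I"
        by (intro I.I_l_closed)
      then show ?thesis
        using u(2) by (simp add: monomial_def mult_single poly_ring_simps(2))
    qed
    have "(\<Sum>t\<in>T. Poly_Mapping.single t (Poly_Mapping.lookup p t)) \<in> ?I"
      if "finite T" "T \<subseteq> Poly_Mapping.keys p" for T
      using that
    proof (induction T rule: finite_induct)
      case empty
      show ?case
        using I.zero_closed by (simp add: poly_ring_simps(4))
    next
      case (insert t T)
      have "Poly_Mapping.single t (Poly_Mapping.lookup p t) \<oplus>\<^bsub>poly_ring X\<^esub>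
          (\<Sum>t\<in>T. Poly_Mapping.single t (Poly_Mapping.lookup p t)) \<in> ?I"
        using insert by (intro I.a_closed single) auto
      then show ?case
        using insert.hyps by (simp add: poly_ring_simps(5))
    qed
    from this[OF finite_keys order_refl] show "p \<in> ?I"
      by (simp only: poly_mapping_sum_single)
  qed
qed

lemma monomial_mem_genideal_iff:
  assumes "\<And>u. u \<in> M \<Longrightarrow> set_mset u \<subseteq> X"
  shows "(monomial t :: ('v, 'k::field) mpoly) \<in> genideal (poly_ring X) (monomial ` M) \<longleftrightarrow>
    set_mset t \<subseteq> X \<and> (\<exists>u\<in>M. u \<subseteq># t)"
  by (simp add: genideal_monomials[OF assms]) (simp add: monomial_def poly_ring_simps(1))

section \<open>Resolutions supported on a labeled complex\<close>

text \<open>The universal property of the least common multiple. The empty set is treated apart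
  because the bound for suprema of multisets requires a nonempty set.\<close>

lemma lcm_label_subseteq_iff:
  assumes "finite A"
  shows "lcm_label m A \<subseteq># t \<longleftrightarrow> (\<forall>i\<in>A. m i \<subseteq># t)"
proof (cases "A = {}")
  case True
  then show ?thesis
    by (simp add: lcm_label_def Sup_multiset_empty)
next
  case False
  have "finite (m ` A)"
    using assms by simp
  then show ?thesis
    unfolding lcm_label_def
    using subset_mset.cSup_le_iff[of "m ` A" t] False by (simp add: subset_mset.bdd_above_finite)
qed

lemma lcm_label_empty: "lcm_label m {} = {#}"
  by (simp add: lcm_label_def Sup_multiset_empty)

lemma lcm_label_mono:
  assumes "finite B" "A \<subseteq> B"
  shows "lcm_label m A \<subseteq># lcm_label m B"
  using assms lcm_label_subseteq_iff[of A m "lcm_label m B"] lcm_label_subseteq_iff[of B m "lcm_label m B"]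
    finite_subset[of A B] by (auto simp: subset_iff)

text \<open>The part of a chain in multidegree \<open>t\<close>.\<close>

definition strand ::
  "(nat \<Rightarrow> 'v multiset) \<Rightarrow> 'v multiset \<Rightarrow> (nat set \<Rightarrow>\<^sub>0 ('v, 'k::field) mpoly) \<Rightarrow> nat set \<Rightarrow> 'k"
  where
  "strand m t c A =
     (if lcm_label m A \<subseteq># t
      then Poly_Mapping.lookup (Poly_Mapping.lookup c A) (t - lcm_label m A) else 0)"

text \<open>The faces whose basis elements contribute in multidegree \<open>t\<close>, usually
  written \<Gamma> with index \<open>\<le> t\<close>.\<close>

definition subcomplex_dividing ::
  "nat set set \<Rightarrow> (nat \<Rightarrow> 'v multiset) \<Rightarrow> 'v multiset \<Rightarrow> nat set set" where
  "subcomplex_dividing \<Gamma> m t = {A \<in> \<Gamma>. lcm_label m A \<subseteq># t}"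

text \<open>Each coefficient is recovered from the strand whose multidegree is the label times the
  monomial, so the strands determine the chain.\<close>

lemma strand_add_label:
  "strand m (lcm_label m A + s) c A = Poly_Mapping.lookup (Poly_Mapping.lookup c A) s"
  by (simp add: strand_def)

lemma strand_eqI:
  assumes "\<And>t. strand m t c = strand m t d"
  shows "c = d"
proof (intro poly_mapping_eqI)
  fix A s
  show "Poly_Mapping.lookup (Poly_Mapping.lookup c A) s = Poly_Mapping.lookup (Poly_Mapping.lookup d A) s"
    by (metis assms strand_add_label)
qed

lemma strand_zero: "strand m t 0 = (\<lambda>_. 0)"
  by (simp add: strand_def fun_eq_iff)

text \<open>The polymorphic sign is 1 or -1 at the same time in the polynomial ring and in the
  field, so it passes from one to the other when a coefficient is extracted.\<close>

lemma lookup_mult_face_sign_monomial: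
  fixes p :: "('v, 'k::field) mpoly"
  shows "Poly_Mapping.lookup (p * (face_sign i A * monomial u)) s =
    (if u \<subseteq># s then Poly_Mapping.lookup p (s - u) * face_sign i A else 0)"
proof -
  have "p * (face_sign i A * monomial u) = p * monomial u \<or> face_sign i A = (- 1 :: ('v, 'k) mpoly)"
    "face_sign i A = (1 :: ('v, 'k) mpoly) \<and> face_sign i A = (1 :: 'k) \<or>
     face_sign i A = (- 1 :: ('v, 'k) mpoly) \<and> face_sign i A = (- 1 :: 'k)"
    unfolding face_sign_def by (cases "even (card {a \<in> A. a < i})"; simp)+
  then show ?thesis
    using lookup_times_single[of p u 1 s] by (auto simp: monomial_def)
qed

text \<open>The quotient of labels in the differential compensates for the change of label.
  Multidegrees are therefore preserved, and within one of them only the sign survives.\<close>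

lemma strand_labeled_boundary:
  assumes "finite V" "Poly_Mapping.keys c \<subseteq> Pow V"
  shows "strand m t (labeled_boundary m c) = bd V (strand m t c)"
proof
  fix B
  have lookup: "Poly_Mapping.lookup (labeled_boundary m c) B =
      (\<Sum>i\<in>V - B. Poly_Mapping.lookup c (insert i B) *
         (face_sign i B * monomial (lcm_label m (insert i B) - lcm_label m B)))"
    unfolding labeled_boundary_def
    using lookup_sum_boundary_terms[OF assms, of "\<lambda>A i y. y *
      (face_sign i A * monomial (lcm_label m A - lcm_label m (A - {i})))" B]
    by (simp add: face_sign_insert_self)
  show "strand m t (labeled_boundary m c) B = bd V (strand m t c) B"
  proof (cases "B \<subseteq> V")
    case False
    then have "Poly_Mapping.lookup c (insert i B) = 0" for i
      using assms(2) by (metis PowD in_keys_iff insert_subset subsetD)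
    then show ?thesis
      unfolding strand_def bd_def lookup by (simp cong: if_cong)
  next
    case True
    then have mono: "lcm_label m B \<subseteq># lcm_label m (insert i B)" for i
      using assms(1) finite_subset by (intro lcm_label_mono) auto
    show ?thesis
    proof (cases "lcm_label m B \<subseteq># t")
      case False
      \<comment> \<open>Labels grow with the set, so no face above \<open>B\<close> contributes and
        both sides are 0.\<close>
      then have "\<not> lcm_label m (insert i B) \<subseteq># t" for i
        using mono subset_mset.order_trans by blast
      then show ?thesis
        using False by (simp add: strand_def bd_def)
    next
      case le: True
      have iff: "lcm_label m (insert i B) - lcm_label m B \<subseteq># t - lcm_label m B \<longleftrightarrow>
          lcm_label m (insert i B) \<subseteq># t" for i
        using mono[of i] le by (metis subset_mset.diff_add subset_mset.le_diff_conv2)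
      show ?thesis
        using le unfolding strand_def bd_def lookup
        by (auto simp: lookup_sum lookup_mult_face_sign_monomial iff
            subset_mset.add_diff_inverse[OF mono] intro!: sum.cong)
    qed
  qed
qed

section \<open>Chains over the polynomial ring and their strands\<close>

context
  fixes X :: "'v set" and m :: "nat \<Rightarrow> 'v multiset" and n :: nat and \<Gamma> :: "nat set set"
  assumes labels: "\<And>i. i \<in> {1..n} \<Longrightarrow> set_mset (m i) \<subseteq> X"
    and complex: "simplicial_complex {1..n} \<Gamma>"
begin

lemmas complexD = simplicial_complexD[OF complex]

lemma set_mset_lcm_label:
  assumes "A \<in> \<Gamma>"
  shows "set_mset (lcm_label m A) \<subseteq> X"
proof
  fix x assume "x \<in># lcm_label m A"
  then obtain i where "i \<in> A" "x \<in># m i"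
    unfolding lcm_label_def by (auto dest: in_Sup_multisetD)
  then show "x \<in> X"
    using labels complexD(3) assms by blast
qed

lemma free_chains_keys: "c \<in> free_chains X \<Gamma> j \<Longrightarrow> Poly_Mapping.keys c \<subseteq> Pow {1..n}"
  using complexD(3) by (auto simp: free_chains_def)

lemma chain_strand:
  assumes "c \<in> free_chains X \<Gamma> j"
  shows "chain (subcomplex_dividing \<Gamma> m t) j (strand m t c)"
  unfolding chain_def
proof (intro allI impI)
  fix A assume "strand m t c A \<noteq> 0"
  then have "lcm_label m A \<subseteq># t" "A \<in> Poly_Mapping.keys c"
    by (auto simp: strand_def in_keys_iff split: if_splits)
  then show "A \<in> subcomplex_dividing \<Gamma> m t \<and> card A = j"
    using assms by (simp add: free_chains_def subcomplex_dividing_def)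
qed

text \<open>The multidegree of a nonzero strand is a label times a monomial of a coefficient, and
  both use only variables from \<open>X\<close>.\<close>

lemma strand_support:
  assumes "c \<in> free_chains X \<Gamma> j" "strand m t c A \<noteq> 0"
  shows "set_mset t \<subseteq> X"
proof -
  have A: "lcm_label m A \<subseteq># t" and nz: "Poly_Mapping.lookup (Poly_Mapping.lookup c A) (t - lcm_label m A) \<noteq> 0"
    using assms(2) by (auto simp: strand_def split: if_splits)
  have key: "A \<in> Poly_Mapping.keys c"
    using nz by (auto simp: in_keys_iff)
  then have "A \<in> \<Gamma>" "Poly_Mapping.lookup c A \<in> carrier (poly_ring X)"
    using assms(1) by (simp_all add: free_chains_def)
  then have "set_mset (t - lcm_label m A) \<subseteq> X" "set_mset (lcm_label m A) \<subseteq> X"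
    using nz set_mset_lcm_label by (simp_all add: poly_ring_simps(1) in_keys_iff)
  moreover have "set_mset t = set_mset (t - lcm_label m A) \<union> set_mset (lcm_label m A)"
    using A by (metis set_mset_union subset_mset.diff_add)
  ultimately show ?thesis
    by simp
qed

text \<open>Every term of every coefficient shows up in some strand, so faces, cardinalities and
  variables can all be checked there.\<close>

lemma free_chainsI:
  assumes "\<And>t. chain \<Gamma> j (strand m t c)"
    and "\<And>t A. strand m t c A \<noteq> 0 \<Longrightarrow> set_mset t \<subseteq> X"
  shows "c \<in> free_chains X \<Gamma> j"
  unfolding free_chains_def
proof (intro CollectI ballI conjI)
  fix A assume "A \<in> Poly_Mapping.keys c"
  then obtain s where "Poly_Mapping.lookup (Poly_Mapping.lookup c A) s \<noteq> 0"
    by (metis in_keys_iff lookup_zero poly_mapping_eqI)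
  then have "strand m (lcm_label m A + s) c A \<noteq> 0"
    by (simp add: strand_add_label)
  then show "A \<in> \<Gamma>" "card A = j"
    using chainD[OF assms(1)] by blast+
  show "Poly_Mapping.lookup c A \<in> carrier (poly_ring X)"
    unfolding poly_ring_simps(1)
  proof (intro CollectI ballI)
    fix s assume "s \<in> Poly_Mapping.keys (Poly_Mapping.lookup c A)"
    then have "strand m (lcm_label m A + s) c A \<noteq> 0"
      by (simp add: strand_add_label in_keys_iff)
    then have "set_mset (lcm_label m A + s) \<subseteq> X"
      by (rule assms(2))
    then show "set_mset s \<subseteq> X"
      by simp
  qed
qed

text \<open>Read off from \<open>bd\<close> on strands. No new variables arise, since a nonzero
  boundary value comes from a nonzero value in the same multidegree.\<close>

lemma labeled_boundary_free_chains:
  assumes "c \<in> free_chains X \<Gamma> (Suc j)"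
  shows "labeled_boundary m c \<in> free_chains X \<Gamma> j"
proof -
  have strand: "strand m t (labeled_boundary m c) = bd {1..n} (strand m t c)" for t
    using strand_labeled_boundary[OF _ free_chains_keys[OF assms]] by simp
  show ?thesis
  proof (rule free_chainsI)
    fix t
    have "chain \<Gamma> (Suc j) (strand m t c)"
      using chain_strand[OF assms, of t] by (simp add: chain_def subcomplex_dividing_def)
    then show "chain \<Gamma> j (strand m t (labeled_boundary m c))"
      unfolding strand using complexD(1,3,5) by (intro chain_bd)
  next
    fix t B assume "strand m t (labeled_boundary m c) B \<noteq> 0"
    then obtain i where "strand m t c (insert i B) \<noteq> 0"
      unfolding strand by (rule bd_nonzeroE)
    then show "set_mset t \<subseteq> X"
      by (rule strand_support[OF assms])
  qed
qed

lemma labeled_boundary_labeled_boundary: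
  assumes "c \<in> free_chains X \<Gamma> (Suc j)"
  shows "labeled_boundary m (labeled_boundary m c) = 0"
proof (rule strand_eqI)
  fix t
  have "strand m t (labeled_boundary m (labeled_boundary m c)) =
      bd {1..n} (bd {1..n} (strand m t c))"
    using strand_labeled_boundary[OF _ free_chains_keys[OF assms]]
      strand_labeled_boundary[OF _ free_chains_keys[OF labeled_boundary_free_chains[OF assms]]]
    by simp
  moreover have "bd {1..n} (bd {1..n} (strand m t c)) B = 0" for B
    using chainD(1)[OF chain_strand[OF assms, of t]] complexD(3)
    by (intro bd_bd[OF complexD(1)]) (auto simp: subcomplex_dividing_def)
  ultimately show "strand m t (labeled_boundary m (labeled_boundary m c)) = strand m t 0"
    by (simp add: strand_zero fun_eq_iff)
qed

text \<open>Only finitely many strands of \<open>c\<close> are nonzero, so chosen preimages of the strands assemble to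
  polynomials.\<close>

lemma lift_strand_boundaries:
  assumes c: "c \<in> free_chains X \<Gamma> j"
    and strands: "\<And>t. set_mset t \<subseteq> X \<Longrightarrow>
      \<exists>g. chain (subcomplex_dividing \<Gamma> m t) (Suc j) g \<and> bd {1..n} g = strand m t c"
  obtains d where "d \<in> free_chains X \<Gamma> (Suc j)" "labeled_boundary m d = c"
proof -
  define T where "T = {t. \<exists>A. strand m t c A \<noteq> 0}"
  have "T \<subseteq> (\<Union>A\<in>Poly_Mapping.keys c.
      (\<lambda>s. lcm_label m A + s) ` Poly_Mapping.keys (Poly_Mapping.lookup c A))"
  proof
    fix t assume "t \<in> T"
    then obtain A where "strand m t c A \<noteq> 0"
      by (auto simp: T_def)
    then have *: "lcm_label m A \<subseteq># t"
      "Poly_Mapping.lookup (Poly_Mapping.lookup c A) (t - lcm_label m A) \<noteq> 0"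
      by (auto simp: strand_def split: if_splits)
    then have "A \<in> Poly_Mapping.keys c" "t = lcm_label m A + (t - lcm_label m A)"
      "t - lcm_label m A \<in> Poly_Mapping.keys (Poly_Mapping.lookup c A)"
      by (auto simp: in_keys_iff)
    then show "t \<in> (\<Union>A\<in>Poly_Mapping.keys c.
        (\<lambda>s. lcm_label m A + s) ` Poly_Mapping.keys (Poly_Mapping.lookup c A))"
      by blast
  qed
  then have finT: "finite T"
    by (rule finite_subset) simp
  \<comment> \<open>Choosing 0 outside \<open>T\<close> keeps the supports of the assembled
    coefficients finite.\<close>
  have "\<exists>g. chain (subcomplex_dividing \<Gamma> m t) (Suc j) g \<and> bd {1..n} g = strand m t c \<and>
      (t \<notin> T \<longrightarrow> g = (\<lambda>_. 0))" for t
  proof (cases "t \<in> T")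
    case True
    then have "set_mset t \<subseteq> X"
      using strand_support[OF c] by (auto simp: T_def)
    then show ?thesis
      using strands True by blast
  next
    case False
    then have "strand m t c = (\<lambda>_. 0)"
      by (auto simp: T_def)
    then show ?thesis
      by (intro exI[of _ "\<lambda>_. 0"]) (simp add: chain_def bd_def fun_eq_iff)
  qed
  then obtain g where g: "\<And>t. chain (subcomplex_dividing \<Gamma> m t) (Suc j) (g t)"
    "\<And>t. bd {1..n} (g t) = strand m t c" "\<And>t. t \<notin> T \<Longrightarrow> g t = (\<lambda>_. 0)"
    by metis
  \<comment> \<open>Exponent \<open>s\<close> at the face \<open>A\<close> belongs to multidegree
    \<open>lcm_label m A + s\<close>. Multidegrees not divisible by the label are left out, and
    there \<open>g\<close> vanishes at \<open>A\<close>.\<close>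
  define q where "q A = Abs_poly_mapping (\<lambda>s. g (lcm_label m A + s) A)" for A
  have lookup_q: "Poly_Mapping.lookup (q A) s = g (lcm_label m A + s) A" for A s
  proof -
    have "{s. g (lcm_label m A + s) A \<noteq> 0} \<subseteq> (\<lambda>t. t - lcm_label m A) ` T"
    proof
      fix s assume "s \<in> {s. g (lcm_label m A + s) A \<noteq> 0}"
      then have "lcm_label m A + s \<in> T"
        using g(3)[of "lcm_label m A + s"] by force
      then show "s \<in> (\<lambda>t. t - lcm_label m A) ` T"
        by (rule rev_image_eqI) simp
    qed
    then have "finite {s. g (lcm_label m A + s) A \<noteq> 0}"
      using finT finite_subset by blast
    then show ?thesis
      by (simp add: q_def)
  qed
  define d where "d = Abs_poly_mapping q"
  have lookup_d: "Poly_Mapping.lookup d = q"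
  proof -
    have "{A. q A \<noteq> 0} \<subseteq> \<Gamma>"
    proof
      fix A assume "A \<in> {A. q A \<noteq> 0}"
      then obtain s where "Poly_Mapping.lookup (q A) s \<noteq> 0"
        by (metis lookup_zero mem_Collect_eq poly_mapping_eqI)
      then show "A \<in> \<Gamma>"
        using chainD(1)[OF g(1)] by (auto simp: lookup_q subcomplex_dividing_def)
    qed
    then have "finite {A. q A \<noteq> 0}"
      using complexD(6) finite_subset by blast
    then show ?thesis
      by (simp add: d_def)
  qed
  have strand_d: "strand m t d = g t" for t
  proof
    fix A
    show "strand m t d A = g t A"
    proof (cases "lcm_label m A \<subseteq># t")
      case True
      then show ?thesis
        by (simp add: strand_def lookup_d lookup_q)
    next
      case False
      then have "g t A = 0"
        using chainD(1)[OF g(1)] by (auto simp: subcomplex_dividing_def)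
      then show ?thesis
        using False by (simp add: strand_def)
    qed
  qed
  have d: "d \<in> free_chains X \<Gamma> (Suc j)"
  proof (rule free_chainsI)
    show "chain \<Gamma> (Suc j) (strand m t d)" for t
      using g(1)[of t] by (simp add: strand_d chain_def subcomplex_dividing_def)
    fix t A assume "strand m t d A \<noteq> 0"
    then have "t \<in> T"
      using g(3)[of t] by (force simp: strand_d)
    then show "set_mset t \<subseteq> X"
      using strand_support[OF c] by (auto simp: T_def)
  qed
  moreover have "labeled_boundary m d = c"
  proof (rule strand_eqI)
    fix t
    show "strand m t (labeled_boundary m d) = strand m t c"
      using strand_labeled_boundary[OF complexD(1) free_chains_keys[OF d], of m t]
      by (simp only: strand_d g(2))
  qed
  ultimately show ?thesis
    by (rule that)
qed

text \<open>The criterion of Bayer, Peeva and Sturmfels.\<close>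

lemma resolves_quotient_if_exact:
  assumes exact: "\<And>t j. set_mset t \<subseteq> X \<Longrightarrow> 1 \<le> j \<or> subcomplex_dividing \<Gamma> m t \<noteq> {{}} \<Longrightarrow>
      exact_at TYPE('k::field) {1..n} (subcomplex_dividing \<Gamma> m t) j"
  shows "resolves_quotient X \<Gamma> m
    (genideal (poly_ring X) (monomial ` m ` {1..n}) :: ('v, 'k) mpoly set)"
    (is "resolves_quotient X \<Gamma> m ?I")
proof -
  interpret cring "poly_ring X :: ('v, 'k) mpoly ring"
    by (rule cring_poly_ring)
  have I_eq: "?I = {p \<in> carrier (poly_ring X).
      \<forall>t\<in>Poly_Mapping.keys p. \<exists>u\<in>m ` {1..n}. u \<subseteq># t}"
    by (rule genideal_monomials) (use labels in blast)
  interpret I: ideal ?I "poly_ring X :: ('v, 'k) mpoly ring"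
    using labels
    by (intro genideal_ideal) (simp add: monomial_def poly_ring_simps(1) image_subset_iff)
  have strand_cycle: "bd {1..n} (strand m t c) = (\<lambda>_. 0)"
    if "c \<in> free_chains X \<Gamma> j" "labeled_boundary m c = 0"
    for t j and c :: "nat set \<Rightarrow>\<^sub>0 ('v, 'k) mpoly"
    using strand_labeled_boundary[OF complexD(1) free_chains_keys[OF that(1)], of m t] that(2)
    by (simp only: strand_zero)
  have positive: "{c \<in> free_chains X \<Gamma> j. labeled_boundary m c = (0 :: nat set \<Rightarrow>\<^sub>0 ('v, 'k) mpoly)} =
      labeled_boundary m ` free_chains X \<Gamma> (Suc j)" if "1 \<le> j" for j
  proof (intro equalityI subsetI)
    fix c :: "nat set \<Rightarrow>\<^sub>0 ('v, 'k) mpoly"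
    assume "c \<in> {c \<in> free_chains X \<Gamma> j. labeled_boundary m c = 0}"
    then have c: "c \<in> free_chains X \<Gamma> j" "labeled_boundary m c = 0"
      by simp_all
    have "\<exists>g. chain (subcomplex_dividing \<Gamma> m t) (Suc j) g \<and> bd {1..n} g = strand m t c"
      if "set_mset t \<subseteq> X" for t
      using exact[OF that] \<open>1 \<le> j\<close> chain_strand[OF c(1)] strand_cycle[OF c]
      unfolding exact_at_def by blast
    then obtain d where "d \<in> free_chains X \<Gamma> (Suc j)" "labeled_boundary m d = c"
      using lift_strand_boundaries[OF c(1)] by blast
    then show "c \<in> labeled_boundary m ` free_chains X \<Gamma> (Suc j)"
      by blast
  next
    fix c :: "nat set \<Rightarrow>\<^sub>0 ('v, 'k) mpoly"
    assume "c \<in> labeled_boundary m ` free_chains X \<Gamma> (Suc j)"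
    then obtain d where d: "d \<in> free_chains X \<Gamma> (Suc j)" "c = labeled_boundary m d"
      by blast
    then show "c \<in> {c \<in> free_chains X \<Gamma> j. labeled_boundary m c = 0}"
      using labeled_boundary_free_chains[OF d(1)] labeled_boundary_labeled_boundary[OF d(1)] by simp
  qed
  have lookup_carrier: "Poly_Mapping.lookup c {} \<in> carrier (poly_ring X)"
    if "c \<in> free_chains X \<Gamma> 0" for c :: "nat set \<Rightarrow>\<^sub>0 ('v, 'k) mpoly"
  proof (cases "{} \<in> Poly_Mapping.keys c")
    case True
    then show ?thesis
      using that by (simp add: free_chains_def)
  next
    case False
    then show ?thesis
      by (simp add: in_keys_iff poly_ring_simps(1))
  qed
  have augmentation_zero: "augmentation X ?I c = \<zero>\<^bsub>poly_ring X Quot ?I\<^esub> \<longleftrightarrow> Poly_Mapping.lookup c {} \<in> ?I"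
    if "c \<in> free_chains X \<Gamma> 0" for c :: "nat set \<Rightarrow>\<^sub>0 ('v, 'k) mpoly"
  proof
    assume "augmentation X ?I c = \<zero>\<^bsub>poly_ring X Quot ?I\<^esub>"
    then show "Poly_Mapping.lookup c {} \<in> ?I"
      by (intro I.rcos_const_imp_mem lookup_carrier[OF that]) (simp add: augmentation_def FactRing_def)
  next
    assume "Poly_Mapping.lookup c {} \<in> ?I"
    then show "augmentation X ?I c = \<zero>\<^bsub>poly_ring X Quot ?I\<^esub>"
      using a_rcos_zero[OF I.is_ideal] by (simp add: augmentation_def FactRing_def)
  qed
  have zero: "{c \<in> free_chains X \<Gamma> 0. augmentation X ?I c = \<zero>\<^bsub>poly_ring X Quot ?I\<^esub>} =
      labeled_boundary m ` free_chains X \<Gamma> 1"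
  proof (intro equalityI subsetI)
    fix c :: "nat set \<Rightarrow>\<^sub>0 ('v, 'k) mpoly"
    assume "c \<in> {c \<in> free_chains X \<Gamma> 0. augmentation X ?I c = \<zero>\<^bsub>poly_ring X Quot ?I\<^esub>}"
    then have c: "c \<in> free_chains X \<Gamma> 0" and "Poly_Mapping.lookup c {} \<in> ?I"
      using augmentation_zero by auto
    then have in_I: "\<exists>i\<in>{1..n}. m i \<subseteq># t" if "t \<in> Poly_Mapping.keys (Poly_Mapping.lookup c {})" for t
      using that unfolding I_eq by blast
    have "\<exists>g. chain (subcomplex_dividing \<Gamma> m t) (Suc 0) g \<and> bd {1..n} g = strand m t c"
      if t: "set_mset t \<subseteq> X" for t
    proof (cases "subcomplex_dividing \<Gamma> m t = {{}}")
      case False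
      have chain: "chain (subcomplex_dividing \<Gamma> m t) 0 (strand m t c)"
        by (rule chain_strand[OF c])
      \<comment> \<open>A chain in index 0 sits on the empty face and is automatically a
        cycle.\<close>
      have "strand m t c (insert i B) = 0" for i B
      proof (rule ccontr)
        assume "strand m t c (insert i B) \<noteq> 0"
        then have "insert i B \<in> \<Gamma>" "card (insert i B) = 0"
          using chainD[OF chain] by (auto simp: subcomplex_dividing_def)
        then show False
          using finite_face[OF complex] by fastforce
      qed
      then have "bd {1..n} (strand m t c) = (\<lambda>_. 0)"
        by (simp add: bd_def fun_eq_iff)
      then show ?thesis
        using exact[OF t] False chain unfolding exact_at_def by blast
    next
      case True
      have "strand m t c A = 0" for A
      proof (rule ccontr)
        assume nz: "strand m t c A \<noteq> 0"
        then have "A = {}"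
          using chainD(1)[OF chain_strand[OF c]] True by fastforce
        then have "t \<in> Poly_Mapping.keys (Poly_Mapping.lookup c {})"
          using nz by (simp add: strand_def lcm_label_empty in_keys_iff)
        then obtain i where "i \<in> {1..n}" "m i \<subseteq># t"
          using in_I by blast
        then have "{i} \<in> subcomplex_dividing \<Gamma> m t"
          using complexD(7) by (simp add: subcomplex_dividing_def lcm_label_subseteq_iff)
        then show False
          using True by simp
      qed
      then show ?thesis
        by (intro exI[of _ "\<lambda>_. 0"]) (simp add: chain_def bd_def fun_eq_iff)
    qed
    then obtain d where "d \<in> free_chains X \<Gamma> (Suc 0)" "labeled_boundary m d = c"
      using lift_strand_boundaries[OF c] by blast
    then show "c \<in> labeled_boundary m ` free_chains X \<Gamma> 1"
      by auto
  next
    fix c :: "nat set \<Rightarrow>\<^sub>0 ('v, 'k) mpoly"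
    assume "c \<in> labeled_boundary m ` free_chains X \<Gamma> 1"
    then obtain d where d: "d \<in> free_chains X \<Gamma> (Suc 0)" "c = labeled_boundary m d"
      by auto
    have c: "c \<in> free_chains X \<Gamma> 0"
      using labeled_boundary_free_chains[OF d(1)] d(2) by simp
    \<comment> \<open>The empty face receives contributions only from vertices, whose labels are the
      generators.\<close>
    have "\<exists>u\<in>m ` {1..n}. u \<subseteq># t" if "t \<in> Poly_Mapping.keys (Poly_Mapping.lookup c {})" for t
    proof -
      have "strand m t c {} \<noteq> 0"
        using that by (simp add: strand_def lcm_label_empty in_keys_iff)
      then have "bd {1..n} (strand m t d) {} \<noteq> 0"
        unfolding d(2) strand_labeled_boundary[OF complexD(1) free_chains_keys[OF d(1)]] .
      then obtain i where i: "i \<in> {1..n} - {}" "strand m t d {i} \<noteq> 0"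
        by (rule bd_nonzeroE)
      then have "m i \<subseteq># t"
        by (simp add: strand_def lcm_label_subseteq_iff split: if_splits)
      then show ?thesis
        using i(1) by blast
    qed
    then have "Poly_Mapping.lookup c {} \<in> ?I"
      unfolding I_eq using lookup_carrier[OF c] by blast
    then show "c \<in> {c \<in> free_chains X \<Gamma> 0. augmentation X ?I c = \<zero>\<^bsub>poly_ring X Quot ?I\<^esub>}"
      using c augmentation_zero by simp
  qed
  have "augmentation X ?I ` free_chains X \<Gamma> 0 = carrier (poly_ring X Quot ?I)"
  proof (intro equalityI subsetI)
    fix x assume "x \<in> augmentation X ?I ` free_chains X \<Gamma> 0"
    then show "x \<in> carrier (poly_ring X Quot ?I)"
      using lookup_carrier by (auto simp: augmentation_def FactRing_def A_RCOSETS_def')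
  next
    fix x assume "x \<in> carrier (poly_ring X Quot ?I)"
    then obtain p where p: "p \<in> carrier (poly_ring X)" "x = ?I +>\<^bsub>poly_ring X\<^esub> p"
      by (auto simp: FactRing_def A_RCOSETS_def')
    have "Poly_Mapping.single {} p \<in> free_chains X \<Gamma> 0"
      using p(1) complexD(4) by (simp add: free_chains_def)
    moreover have "augmentation X ?I (Poly_Mapping.single {} p) = x"
      by (simp add: augmentation_def p(2))
    ultimately show "x \<in> augmentation X ?I ` free_chains X \<Gamma> 0"
      by blast
  qed
  with positive zero show ?thesis
    by (simp add: resolves_quotient_def)
qed

text \<open>A constant term in the coefficient at \<open>B\<close> would come from some
  \<open>insert i B\<close> with the same label as \<open>B\<close>, which the hypothesis forbids;
  any other term contains a variable.\<close>

lemma minimal_differential_if_labels_differ: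
  assumes "\<And>A i. A \<in> \<Gamma> \<Longrightarrow> i \<in> A \<Longrightarrow> lcm_label m (A - {i}) \<noteq> lcm_label m A"
  shows "minimal_differential X TYPE('k::field) \<Gamma> m"
  unfolding minimal_differential_def
proof (intro allI impI ballI)
  fix j B and c :: "nat set \<Rightarrow>\<^sub>0 ('v, 'k) mpoly"
  assume "1 \<le> j" "c \<in> free_chains X \<Gamma> j"
  then obtain j' where c: "c \<in> free_chains X \<Gamma> (Suc j')"
    using Suc_le_D by auto
  let ?p = "Poly_Mapping.lookup (labeled_boundary m c) B"
  have carrier: "?p \<in> carrier (poly_ring X)"
  proof (cases "B \<in> Poly_Mapping.keys (labeled_boundary m c)")
    case True
    then show ?thesis
      using labeled_boundary_free_chains[OF c] by (simp add: free_chains_def)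
  next
    case False
    then show ?thesis
      by (simp add: in_keys_iff poly_ring_simps(1))
  qed
  have "\<exists>u\<in>(\<lambda>x. {#x#}) ` X. u \<subseteq># t" if t: "t \<in> Poly_Mapping.keys ?p" for t
  proof (cases "t = {#}")
    case True
    \<comment> \<open>The constant term of the coefficient at \<open>B\<close> lies in the
      multidegree of the label of \<open>B\<close>.\<close>
    then have "strand m (lcm_label m B) (labeled_boundary m c) B \<noteq> 0"
      using t strand_add_label[of m B "{#}" "labeled_boundary m c"] by (simp add: in_keys_iff)
    then obtain i where i: "i \<in> {1..n} - B" "strand m (lcm_label m B) c (insert i B) \<noteq> 0"
      unfolding strand_labeled_boundary[OF complexD(1) free_chains_keys[OF c]]
      by (rule bd_nonzeroE)
    then have "insert i B \<in> \<Gamma>" "lcm_label m (insert i B) \<subseteq># lcm_label m B"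
      using chainD(1)[OF chain_strand[OF c] i(2)] by (simp_all add: subcomplex_dividing_def)
    moreover have "lcm_label m B \<subseteq># lcm_label m (insert i B)"
      using finite_face[OF complex \<open>insert i B \<in> \<Gamma>\<close>] by (intro lcm_label_mono) auto
    ultimately have "lcm_label m (insert i B - {i}) = lcm_label m (insert i B)"
      using i(1) by (simp add: subset_mset.antisym)
    then show ?thesis
      using assms[of "insert i B" i] \<open>insert i B \<in> \<Gamma>\<close> by simp
  next
    case False
    then obtain x where "x \<in># t"
      by blast
    moreover have "set_mset t \<subseteq> X"
      using carrier t by (simp add: poly_ring_simps(1))
    ultimately show ?thesis
      by (auto intro!: bexI[of _ "{#x#}"])
  qed
  then have "?p \<in> genideal (poly_ring X) (monomial ` (\<lambda>x. {#x#}) ` X)"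
    using carrier by (subst genideal_monomials) auto
  then show "?p \<in> genideal (poly_ring X) ((\<lambda>x. monomial {#x#}) ` X)"
    by (simp add: image_image)
qed

end

section \<open>The Scarf complex of the ideal\<close>

lemma mset_set_subseteq_iff:
  assumes "finite U"
  shows "mset_set U \<subseteq># t \<longleftrightarrow> U \<subseteq> set_mset t"
proof
  assume "mset_set U \<subseteq># t"
  then show "U \<subseteq> set_mset t"
    using set_mset_mono assms by fastforce
next
  assume "U \<subseteq> set_mset t"
  then have "count (mset_set U) x \<le> count t x" for x
    using assms by (cases "x \<in> U") (auto simp: Suc_le_eq)
  then show "mset_set U \<subseteq># t"
    by (simp add: subseteq_mset_def)
qed

section \<open>Labels in terms of facets and ridges\<close>

text \<open>The set \<open>T\<close> of the outline; the ridges are included so that distinct faces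
  can be separated.\<close>

definition facets_and_ridges :: "nat set set \<Rightarrow> nat set set" where
  "facets_and_ridges \<Delta> = facets \<Delta> \<union> {F - {w} | F w. F \<in> facets \<Delta> \<and> w \<in> F}"

context
  fixes n :: nat and \<Delta> :: "nat set set"
  assumes complex: "simplicial_complex {1..n} \<Delta>"
begin

lemmas \<Delta>_complex = simplicial_complexD[OF complex]

lemma facets_and_ridges_subset: "facets_and_ridges \<Delta> \<subseteq> \<Delta>"
  using \<Delta>_complex(5) by (auto simp: facets_and_ridges_def facets_def down_closed_def)

lemma finite_facets_and_ridges: "finite (facets_and_ridges \<Delta>)"
  using facets_and_ridges_subset \<Delta>_complex(6) finite_subset by blast

text \<open>Among a facet \<open>F\<close> and its ridges \<open>F - {w}\<close>, all avoid
  \<open>v\<close> if \<open>F\<close> does; otherwise only \<open>F - {v}\<close> does. The radical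
  removes multiplicities.\<close>

lemma vertex_monomial_eq: "vertex_monomial \<Delta> v = mset_set {\<tau> \<in> facets_and_ridges \<Delta>. v \<notin> \<tau>}"
proof -
  have fin: "finite F" if "F \<in> facets \<Delta>" for F
    using that finite_face[OF complex] by (simp add: facets_def)
  have fin_facets: "finite (facets_containing \<Delta> v)" "finite (facets_avoiding \<Delta> v)"
    using \<Delta>_complex(6) by (simp_all add: facets_containing_def facets_avoiding_def facets_def)
  \<comment> \<open>For the empty facet both sides are empty, so the truncated
    \<open>card F - 1\<close> is harmless.\<close>
  have ridges: "{\<sigma>. \<sigma> \<subset> F \<and> card \<sigma> = card F - 1} = (\<lambda>w. F - {w}) ` F" if F: "F \<in> facets \<Delta>" for F
  proof (intro equalityI subsetI)
    fix \<sigma> assume "\<sigma> \<in> {\<sigma>. \<sigma> \<subset> F \<and> card \<sigma> = card F - 1}"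
    then have \<sigma>: "\<sigma> \<subset> F" "card \<sigma> = card F - 1"
      by simp_all
    have "finite \<sigma>" "card \<sigma> < card F"
      using fin[OF F] \<sigma>(1) psubset_card_mono finite_subset by blast+
    then have "card (F - \<sigma>) = 1"
      using \<sigma> by (simp add: card_Diff_subset psubset_imp_subset)
    then obtain w where "F - \<sigma> = {w}"
      by (auto simp: card_1_singleton_iff)
    then show "\<sigma> \<in> (\<lambda>w. F - {w}) ` F"
      using \<sigma>(1) by blast
  next
    fix \<sigma> assume "\<sigma> \<in> (\<lambda>w. F - {w}) ` F"
    then show "\<sigma> \<in> {\<sigma>. \<sigma> \<subset> F \<and> card \<sigma> = card F - 1}"
      using fin[OF F] by auto
  qed
  have avoiding: "set_mset (\<Sum>\<sigma> | \<sigma> \<subset> F \<and> card \<sigma> = card F - 1. {#\<sigma>#}) = (\<lambda>w. F - {w}) ` F"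
    if "F \<in> facets_avoiding \<Delta> v" for F
  proof -
    have F: "F \<in> facets \<Delta>"
      using that by (simp add: facets_avoiding_def)
    show ?thesis
      unfolding ridges[OF F] using fin[OF F] by (subst set_mset_sum) auto
  qed
  have "set_mset ((\<Sum>G\<in>facets_containing \<Delta> v. {#G - {v}#}) +
     (\<Sum>F\<in>facets_avoiding \<Delta> v. {#F#} + (\<Sum>\<sigma> | \<sigma> \<subset> F \<and> card \<sigma> = card F - 1. {#\<sigma>#}))) =
     (\<lambda>G. G - {v}) ` facets_containing \<Delta> v \<union>
     (\<Union>F\<in>facets_avoiding \<Delta> v. insert F ((\<lambda>w. F - {w}) ` F))"
    using fin_facets avoiding by (auto simp: set_mset_sum)
  also have "\<dots> = {\<tau> \<in> facets_and_ridges \<Delta>. v \<notin> \<tau>}"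
    unfolding facets_and_ridges_def facets_containing_def facets_avoiding_def by blast
  finally show ?thesis
    by (simp only: vertex_monomial_def mono_sqrt_def)
qed

text \<open>A set \<open>\<tau>\<close> misses some vertex of \<open>A\<close> exactly if
  \<open>A\<close> is not contained in it. Comparing the multiples of both sides avoids computing
  the supremum.\<close>

lemma lcm_label_vertex_monomial:
  assumes "finite A"
  shows "lcm_label (vertex_monomial \<Delta>) A = mset_set {\<tau> \<in> facets_and_ridges \<Delta>. \<not> A \<subseteq> \<tau>}"
proof -
  have "lcm_label (vertex_monomial \<Delta>) A \<subseteq># t \<longleftrightarrow>
      mset_set {\<tau> \<in> facets_and_ridges \<Delta>. \<not> A \<subseteq> \<tau>} \<subseteq># t" for t
    using finite_facets_and_ridges
    by (auto simp: lcm_label_subseteq_iff[OF assms] vertex_monomial_eq mset_set_subseteq_iff subset_iff)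
  then show ?thesis
    by (meson subset_mset.antisym subset_mset.order_refl)
qed

lemma lcm_label_vertex_monomial_eq_iff:
  assumes "finite A" "finite B"
  shows "lcm_label (vertex_monomial \<Delta>) A = lcm_label (vertex_monomial \<Delta>) B \<longleftrightarrow>
    (\<forall>\<tau>\<in>facets_and_ridges \<Delta>. A \<subseteq> \<tau> \<longleftrightarrow> B \<subseteq> \<tau>)"
  using finite_facets_and_ridges
  by (auto simp: lcm_label_vertex_monomial assms mset_set_eq_iff)

text \<open>Take a facet \<open>F\<close> above \<open>A\<close> and some \<open>b\<close> in
  \<open>B\<close> outside \<open>A\<close>: \<open>F - {b}\<close> is a ridge if \<open>b\<close>
  lies in \<open>F\<close>, and \<open>F\<close> itself otherwise.\<close>

lemma exists_facet_or_ridge: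
  assumes "A \<in> \<Delta>" "\<not> B \<subseteq> A"
  obtains \<tau> where "\<tau> \<in> facets_and_ridges \<Delta>" "A \<subseteq> \<tau>" "\<not> B \<subseteq> \<tau>"
proof -
  obtain F where F: "F \<in> facets \<Delta>" "A \<subseteq> F"
    using face_subset_facet[OF \<Delta>_complex(6) assms(1)] .
  obtain b where b: "b \<in> B" "b \<notin> A"
    using assms(2) by blast
  have "F - {b} \<in> facets_and_ridges \<Delta>"
    using F(1) by (cases "b \<in> F") (auto simp: facets_and_ridges_def)
  moreover have "A \<subseteq> F - {b}" "\<not> B \<subseteq> F - {b}"
    using F(2) b by auto
  ultimately show ?thesis
    by (rule that)
qed

text \<open>The boundary of a simplex must be excluded: its only nonface would have a label of its
  own and enter the Scarf complex.\<close>

lemma scarf_complex_vertex_monomial: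
  assumes "\<not> boundary_of_simplex {1..n} \<Delta>"
  shows "scarf_complex n (vertex_monomial \<Delta>) = \<Delta>"
proof (intro equalityI subsetI)
  fix A assume A: "A \<in> \<Delta>"
  then have AV: "A \<subseteq> {1..n}"
    using \<Delta>_complex(3) by blast
  have "B = A" if "B \<subseteq> {1..n}"
    "lcm_label (vertex_monomial \<Delta>) B = lcm_label (vertex_monomial \<Delta>) A" for B
  proof -
    have "finite A" "finite B"
      using AV that(1) finite_subset by auto
    then have iff: "A \<subseteq> \<tau> \<longleftrightarrow> B \<subseteq> \<tau>" if "\<tau> \<in> facets_and_ridges \<Delta>" for \<tau>
      using \<open>lcm_label (vertex_monomial \<Delta>) B = _\<close> that
      by (auto simp: lcm_label_vertex_monomial_eq_iff)
    \<comment> \<open>Otherwise some facet or ridge would contain \<open>A\<close> but not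
      \<open>B\<close>. Once \<open>B\<close> lies in \<open>A\<close> it is a face, and the same
      separation gives the reverse inclusion.\<close>
    have "B \<subseteq> A"
      using exists_facet_or_ridge[OF A] iff by metis
    moreover have "B \<in> \<Delta>"
      using A \<Delta>_complex(5) \<open>B \<subseteq> A\<close> by (auto simp: down_closed_def)
    then have "A \<subseteq> B"
      using exists_facet_or_ridge iff by metis
    ultimately show ?thesis
      by blast
  qed
  then show "A \<in> scarf_complex n (vertex_monomial \<Delta>)"
    using AV by (auto simp: scarf_complex_def)
next
  fix A assume A: "A \<in> scarf_complex n (vertex_monomial \<Delta>)"
  then have AV: "A \<subseteq> {1..n}"
    by (simp add: scarf_complex_def)
  show "A \<in> \<Delta>"
  proof (rule ccontr)
    assume nA: "A \<notin> \<Delta>"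
    \<comment> \<open>All nonfaces have the same label, so \<open>A\<close> is the only one.\<close>
    have nonface: "\<not> B \<subseteq> \<tau>" if "B \<notin> \<Delta>" "\<tau> \<in> facets_and_ridges \<Delta>" for B \<tau>
      using that facets_and_ridges_subset \<Delta>_complex(5) by (auto simp: down_closed_def)
    have only: "B = A" if "B \<subseteq> {1..n}" "B \<notin> \<Delta>" for B
    proof -
      have "finite A" "finite B"
        using AV that(1) finite_subset by auto
      then have "lcm_label (vertex_monomial \<Delta>) B = lcm_label (vertex_monomial \<Delta>) A"
        using nonface nA that(2) by (auto simp: lcm_label_vertex_monomial_eq_iff)
      then show ?thesis
        using A that(1) by (auto simp: scarf_complex_def)
    qed
    \<comment> \<open>Supersets of nonfaces are nonfaces, so uniqueness forces \<open>A\<close> to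
      be the full vertex set and every proper subset to be a face.\<close>
    have "{1..n} \<notin> \<Delta>"
      using nA AV \<Delta>_complex(5) by (auto simp: down_closed_def)
    then have "A = {1..n}"
      using only by auto
    then have "\<Delta> = {B. B \<subset> {1..n}}"
      using only nA \<Delta>_complex(3) by auto
    then show False
      using assms by (simp add: boundary_of_simplex_def)
  qed
qed

section \<open>Minimal generators and the resolution\<close>

lemma set_mset_vertex_monomial: "set_mset (vertex_monomial \<Delta> i) \<subseteq> \<Delta>"
  unfolding vertex_monomial_eq using facets_and_ridges_subset finite_facets_and_ridges by simp blast

text \<open>Separating the face \<open>{i}\<close> from another vertex \<open>j\<close> yields a
  variable of the \<open>j\<close>-th monomial that is missing in the \<open>i\<close>-th.\<close>

lemma vertex_monomial_subset_iff:
  assumes "i \<in> {1..n}"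
  shows "vertex_monomial \<Delta> j \<subseteq># vertex_monomial \<Delta> i \<longleftrightarrow> i = j"
proof
  assume le: "vertex_monomial \<Delta> j \<subseteq># vertex_monomial \<Delta> i"
  show "i = j"
  proof (rule ccontr)
    assume "i \<noteq> j"
    then have "\<not> {j} \<subseteq> {i}"
      by simp
    then obtain \<tau> where "\<tau> \<in> facets_and_ridges \<Delta>" "{i} \<subseteq> \<tau>" "\<not> {j} \<subseteq> \<tau>"
      by (rule exists_facet_or_ridge[OF \<Delta>_complex(7)[OF assms]])
    then have "\<tau> \<in> {\<tau> \<in> facets_and_ridges \<Delta>. j \<notin> \<tau>}" "\<tau> \<notin> {\<tau> \<in> facets_and_ridges \<Delta>. i \<notin> \<tau>}"
      by simp_all
    then have "\<tau> \<in># vertex_monomial \<Delta> j" "\<tau> \<notin># vertex_monomial \<Delta> i"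
      unfolding vertex_monomial_eq using finite_facets_and_ridges by simp_all
    then show False
      using mset_subset_eqD[OF le] by blast
  qed
qed simp

text \<open>A proper subset of the generators omits some monomial, whose membership in the smaller
  ideal would require another generator dividing it.\<close>

lemma minimal_generators_vertex_monomial:
  "minimal_monomial_generators \<Delta> n (vertex_monomial \<Delta>) (J_ideal n \<Delta> :: (nat set, 'k::field) mpoly set)"
  unfolding minimal_monomial_generators_def
proof (intro conjI allI impI ballI)
  have J: "J_ideal n \<Delta> = genideal (poly_ring \<Delta>)
      (monomial ` vertex_monomial \<Delta> ` {1..n} :: (nat set, 'k) mpoly set)"
    by (simp add: J_ideal_def image_image)
  then show "J_ideal n \<Delta> = genideal (poly_ring \<Delta>)
      (monomial ` vertex_monomial \<Delta> ` {1..n} :: (nat set, 'k) mpoly set)" .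
  show "inj_on (vertex_monomial \<Delta>) {1..n}"
  proof (rule inj_onI)
    fix i j assume "i \<in> {1..n}" "vertex_monomial \<Delta> i = vertex_monomial \<Delta> j"
    then show "i = j"
      using vertex_monomial_subset_iff[of i j] by simp
  qed
  show "set_mset (vertex_monomial \<Delta> i) \<subseteq> \<Delta>" for i
    by (rule set_mset_vertex_monomial)
  fix M assume M: "M \<subset> vertex_monomial \<Delta> ` {1..n}"
  then obtain i where i: "i \<in> {1..n}" "vertex_monomial \<Delta> i \<notin> M"
    by blast
  have support: "set_mset u \<subseteq> \<Delta>" if "u \<in> vertex_monomial \<Delta> ` {1..n}" for u
    using that set_mset_vertex_monomial by blast
  show "J_ideal n \<Delta> \<noteq> genideal (poly_ring \<Delta>) (monomial ` M :: (nat set, 'k) mpoly set)"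
  proof
    assume eq: "J_ideal n \<Delta> = genideal (poly_ring \<Delta>) (monomial ` M :: (nat set, 'k) mpoly set)"
    have "(monomial (vertex_monomial \<Delta> i) :: (nat set, 'k) mpoly) \<in> J_ideal n \<Delta>"
      unfolding J using i(1) set_mset_vertex_monomial[of i]
      by (subst monomial_mem_genideal_iff[OF support]) auto
    moreover have "set_mset u \<subseteq> \<Delta>" if "u \<in> M" for u
      using that M support by (meson psubset_imp_subset subsetD)
    ultimately have "\<exists>u\<in>M. u \<subseteq># vertex_monomial \<Delta> i"
      unfolding eq by (simp only: monomial_mem_genideal_iff)
    then obtain u where u: "u \<in> M" "u \<subseteq># vertex_monomial \<Delta> i" ..
    moreover obtain j where "u = vertex_monomial \<Delta> j"
      using M u(1) by (meson imageE psubset_imp_subset subsetD)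
    ultimately have "i = j"
      using vertex_monomial_subset_iff[OF i(1)] by simp
    then show False
      using u(1) i(2) \<open>u = vertex_monomial \<Delta> j\<close> by simp
  qed
qed

lemma exact_at_subcomplex_dividing:
  assumes acyclic: "acyclic_over TYPE('k::field) \<Delta>"
    and j: "1 \<le> j \<or> subcomplex_dividing \<Delta> (vertex_monomial \<Delta>) t \<noteq> {{}}"
  shows "exact_at TYPE('k) {1..n} (subcomplex_dividing \<Delta> (vertex_monomial \<Delta>) t) j"
proof -
  \<comment> \<open>Labels are squarefree, so only the set of variables of \<open>t\<close> matters;
    a face contributes exactly if it lies in every member of \<open>U\<close>.\<close>
  define U where "U = facets_and_ridges \<Delta> - set_mset t"
  have "lcm_label (vertex_monomial \<Delta>) A \<subseteq># t \<longleftrightarrow> (\<forall>\<tau>\<in>U. A \<subseteq> \<tau>)" if "A \<in> \<Delta>" for A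
  proof -
    have "finite A"
      using finite_face[OF complex that] .
    then show ?thesis
      using finite_facets_and_ridges
      by (auto simp: lcm_label_vertex_monomial mset_set_subseteq_iff U_def)
  qed
  then have sub: "subcomplex_dividing \<Delta> (vertex_monomial \<Delta>) t = {A \<in> \<Delta>. \<forall>\<tau>\<in>U. A \<subseteq> \<tau>}"
    by (auto simp: subcomplex_dividing_def)
  show ?thesis
  proof (cases "U = {}")
    case True
    then show ?thesis
      using acyclic acyclic_over_iff[OF \<Delta>_complex(1,3,5), where 'k = 'k] by (simp add: sub)
  next
    case False
    then obtain \<tau> where \<tau>: "\<tau> \<in> U" "\<tau> \<in> \<Delta>"
      using facets_and_ridges_subset by (auto simp: U_def)
    then have simplex: "subcomplex_dividing \<Delta> (vertex_monomial \<Delta>) t = Pow (\<Inter>U)"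
    proof -
      \<comment> \<open>One member of \<open>U\<close> is a face, so all subsets of the intersection
        are faces.\<close>
      have "A \<in> \<Delta>" if "A \<subseteq> \<Inter>U" for A
        using \<Delta>_complex(5) \<tau>(2) that Inter_lower[OF \<tau>(1)] unfolding down_closed_def by (meson subset_trans)
      then show ?thesis
        unfolding sub by auto
    qed
    show ?thesis
    proof (cases "\<Inter>U = {}")
      case True
      then have eq: "subcomplex_dividing \<Delta> (vertex_monomial \<Delta>) t = {{}}"
        using simplex by simp
      \<comment> \<open>Index 0 is ruled out by the hypothesis on \<open>j\<close>, since the
        subcomplex is \<open>{{}}\<close>.\<close>
      then obtain j' where "j = Suc j'"
        using j by (cases j) simp_all
      then show ?thesis
        by (simp only: eq exact_at_empty_face)
    next
      case False
      have "\<Inter>U \<subseteq> {1..n}"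
        using \<tau> \<Delta>_complex(3) by blast
      then show ?thesis
        unfolding simplex using False by (intro exact_at_simplex) auto
    qed
  qed
qed

lemma scarf_ideal_J_ideal:
  assumes "\<not> boundary_of_simplex {1..n} \<Delta>" "acyclic_over TYPE('k::field) \<Delta>"
  shows "scarf_ideal \<Delta> (J_ideal n \<Delta> :: (nat set, 'k) mpoly set)"
  unfolding scarf_ideal_def
proof (rule exI[of _ n], rule exI[of _ "vertex_monomial \<Delta>"], intro conjI)
  note scarf = scarf_complex_vertex_monomial[OF assms(1)]
  show "minimal_monomial_generators \<Delta> n (vertex_monomial \<Delta>) (J_ideal n \<Delta> :: (nat set, 'k) mpoly set)"
    by (rule minimal_generators_vertex_monomial)
  have "resolves_quotient \<Delta> \<Delta> (vertex_monomial \<Delta>)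
      (genideal (poly_ring \<Delta>) (monomial ` vertex_monomial \<Delta> ` {1..n}) :: (nat set, 'k) mpoly set)"
    by (rule resolves_quotient_if_exact[OF set_mset_vertex_monomial complex])
      (rule exact_at_subcomplex_dividing[OF assms(2)])
  then show "resolves_quotient \<Delta> (scarf_complex n (vertex_monomial \<Delta>)) (vertex_monomial \<Delta>)
      (J_ideal n \<Delta> :: (nat set, 'k) mpoly set)"
    by (simp add: scarf J_ideal_def image_image)
  \<comment> \<open>Minimality: a face of a Scarf complex shares its label with no other set, in
    particular with none obtained by deleting a vertex.\<close>
  have "lcm_label (vertex_monomial \<Delta>) (A - {i}) \<noteq> lcm_label (vertex_monomial \<Delta>) A"
    if "A \<in> \<Delta>" "i \<in> A" for A i
  proof -
    have "A \<in> scarf_complex n (vertex_monomial \<Delta>)"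
      using that(1) scarf by simp
    moreover have "A - {i} \<noteq> A"
      using that(2) by blast
    moreover have "A - {i} \<subseteq> {1..n}"
      using that(1) \<Delta>_complex(3) by blast
    ultimately show ?thesis
      by (simp add: scarf_complex_def)
  qed
  then show "minimal_differential \<Delta> TYPE('k) (scarf_complex n (vertex_monomial \<Delta>)) (vertex_monomial \<Delta>)"
    unfolding scarf
    by (intro minimal_differential_if_labels_differ[OF set_mset_vertex_monomial complex])
qed

end

text \<open>Scarf complexes are defined from minimal generators, so the first part also asserts that
  the vertex monomials generate minimally. The last conjunct covers the case of simplicial
  trees.\<close>

theorem proposition4p3:
  fixes \<Delta> :: "nat set set" and n :: nat
  assumes "simplicial_complex {1..n} \<Delta>"
    and "\<not> boundary_of_simplex {1..n} \<Delta>"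
  shows "(minimal_monomial_generators \<Delta> n (vertex_monomial \<Delta>)
            (J_ideal n \<Delta> :: (nat set, 'k::field) mpoly set) \<and>
          scarf_complex n (vertex_monomial \<Delta>) = \<Delta>) \<and>
         (acyclic_over TYPE('k) \<Delta> \<longrightarrow>
            scarf_ideal \<Delta> (J_ideal n \<Delta> :: (nat set, 'k) mpoly set)) \<and>
         (simplicial_tree {1..n} \<Delta> \<longrightarrow> acyclic_over TYPE('k) \<Delta>)"
  using minimal_generators_vertex_monomial[OF assms(1)] scarf_complex_vertex_monomial[OF assms]
    scarf_ideal_J_ideal[OF assms] simplicial_tree_acyclic by blast

end
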